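(* If the basic semialgebraic formulas $A$ and $B$ are isomorphic (in the sense defined in the context), then $\chi([A])=\chi([B])$ in $K_0(\mathrm{Var}_{\mathbb R})\otimes\mathbb Z[\frac12]$.
   Context: **The ring $K_0(\mathrm{Var}_{\mathbb R})$.** A Zariski-constructible real algebraic variety is given (as a reduced variety over $\mathbb R$) by finitely many real polynomial equations $P_i=0$ and inequations $Q_j\neq 0$ in some affine space. $K_0(\mathrm{Var}_{\mathbb R})$ is the abelian group generated by isomorphism classes $[X]$ of Zariski-constructible real algebraic varieties, subject to $[X]=[Y]+[X\setminus Y]$ for $Y\subset X$ a closed subvariety, with ring structure induced by the product of constructible sets. **Formulas and $\chi$.** A basic semialgebraic formula $A$ in $n$ variables is a finite system of conditions $\{P_i=0,\ Q_j\neq 0,\ R_k>0\}$ with $P_i,Q_j,R_k\in\mathbb R[X_1,\dots,X_n]$; the conditions $R_k>0$ are called inequalities, and $\{A,B\}$ denotes conjunction. $\chi$ takes values in $K_0(\mathrm{Var}_{\mathbb R})\otimes\mathbb Z[\frac12]$: if $A$ has no inequality, $\chi([A])=[A]$ as a constructible set; by induction on the number of inequalities, for $A$ in $n$ variables and $R\in\mathbb R[X_1,\dots,X_n]$, $$\chi([A,R>0]):=\tfrac14\big(\chi([A,Y^2=R])-\chi([A,Y^2=-R])\big)+\tfrac12\chi([A,R\neq0]),$$ with $Y$ a new variable. **Isomorphism of formulas.** The complexification of a real algebraic subvariety (or constructible subset) of $\mathbb R^n$ defined by given real polynomials is the complex algebraic subvariety (constructible subset) of $\mathbb C^n$ defined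 by the same polynomials; the complexification of a real algebraic map is defined similarly. Let $Y,Z\subset\mathbb R^n$ be Zariski constructible, and let $R_1,\dots,R_r,S_1,\dots,S_r\in\mathbb R[X_1,\dots,X_n]$. Let $A$ be the formula given by $Y$ together with $R_1>0,\dots,R_r>0$, and $B$ the formula given by $Z$ together with $S_1>0,\dots,S_r>0$. Let $$V=\{Y,\ Y_1^2=R_1,\dots,Y_r^2=R_r\},\qquad W=\{Z,\ Y_1^2=S_1,\dots,Y_r^2=S_r\}$$ be the corresponding Zariski constructible subsets of $\mathbb R^{n+r}$, endowed with the action of $\{\pm1\}^r$ by multiplication by $-1$ on the indeterminates $Y_1,\dots,Y_r$. The formulas $A$ and $B$ are isomorphic if there exists a real algebraic isomorphism $\phi:V\to W$ which is equivariant with respect to the actions of $\{\pm1\}^r$ on $V$ and $W$, and whose complexification $\phi_{\mathbb C}$ induces a complex algebraic isomorphism between the complexifications $V_{\mathbb C}$ and $W_{\mathbb C}$.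
   Formalization: The complexification of φ is also required to be equivariant for the {±1}^r-actions on V_C and W_C; with equivariance on real points only the claim fails (Y={x=0}, R=-1 versus Z={x²=-1}, S=0). *)

theory Defs
  imports
    Complex_Main
    "HOL-Library.Poly_Mapping"
    "HOL-Computational_Algebra.Group_Closure"
begin

section \<open>Polynomials in the variables \<open>X\<^sub>0, X\<^sub>1, \<dots>\<close>\<close>

type_synonym 'a mpoly = "(nat \<Rightarrow>\<^sub>0 nat) \<Rightarrow>\<^sub>0 'a"

definition Var :: "nat \<Rightarrow> 'a::comm_semiring_1 mpoly" where
  "Var i = Poly_Mapping.single (Poly_Mapping.single i 1) 1"

definition peval :: "'a::comm_semiring_1 mpoly \<Rightarrow> (nat \<Rightarrow> 'a) \<Rightarrow> 'a" where
  "peval p x = (\<Sum>m\<in>Poly_Mapping.keys p.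
     Poly_Mapping.lookup p m * (\<Prod>i\<in>Poly_Mapping.keys m. x i ^ Poly_Mapping.lookup m i))"

definition polys :: "nat \<Rightarrow> 'a::comm_semiring_1 mpoly set" where
  "polys n = {p. \<forall>m\<in>Poly_Mapping.keys p. Poly_Mapping.keys m \<subseteq> {..<n}}"

definition complexify_poly :: "real mpoly \<Rightarrow> complex mpoly" where
  "complexify_poly = Poly_Mapping.map complex_of_real"


section \<open>Zariski-constructible sets\<close>

text \<open>A presentation of a constructible subset of affine space of dimension \<open>nvars\<close> by finitely
  many equations \<open>p = 0\<close> and inequations \<open>q \<noteq> 0\<close>.\<close>

datatype 'p csys =
  CSys (nvars: nat) (eqs: "'p list") (neqs: "'p list")

definition wf_csys :: "'a::comm_semiring_1 mpoly csys \<Rightarrow> bool" where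
  "wf_csys X \<longleftrightarrow> set (eqs X) \<union> set (neqs X) \<subseteq> polys (nvars X)"

text \<open>Points of affine \<open>n\<close>-space are encoded as sequences that vanish from index \<open>n\<close> on.\<close>

definition points :: "'a::field mpoly csys \<Rightarrow> (nat \<Rightarrow> 'a) set" where
  "points X = {x. (\<forall>i\<ge>nvars X. x i = 0) \<and>
     (\<forall>p\<in>set (eqs X). peval p x = 0) \<and> (\<forall>q\<in>set (neqs X). peval q x \<noteq> 0)}"

definition complexify :: "real mpoly csys \<Rightarrow> complex mpoly csys" where
  "complexify X =
     CSys (nvars X) (map complexify_poly (eqs X)) (map complexify_poly (neqs X))"


section \<open>Algebraic maps\<close>

text \<open>The \<open>i\<close>-th coordinate of a map is the fraction \<open>p / q\<close> with \<open>F i = (p, q)\<close>. Keeping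
  the polynomials rather than the induced function is what makes the complexification of a real
  map well defined, also when the source has few real points.\<close>

type_synonym 'a fracs = "nat \<Rightarrow> 'a mpoly \<times> 'a mpoly"

definition complexify_fracs :: "real fracs \<Rightarrow> complex fracs" where
  "complexify_fracs F = (\<lambda>i. map_prod complexify_poly complexify_poly (F i))"

definition fracs_apply :: "nat \<Rightarrow> 'a::field fracs \<Rightarrow> (nat \<Rightarrow> 'a) \<Rightarrow> nat \<Rightarrow> 'a" where
  "fracs_apply m F x =
     (\<lambda>i. if i < m then peval (fst (F i)) x / peval (snd (F i)) x else 0)"

definition algebraic_map :: "'a::field mpoly csys \<Rightarrow> 'a mpoly csys \<Rightarrow> 'a fracs \<Rightarrow> bool" where
  "algebraic_map X Y F \<longleftrightarrow>
     (\<forall>i<nvars Y. fst (F i) \<in> polys (nvars X) \<and> snd (F i) \<in> polys (nvars X) \<and>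
        (\<forall>x\<in>points X. peval (snd (F i)) x \<noteq> 0)) \<and>
     (\<forall>x\<in>points X. fracs_apply (nvars Y) F x \<in> points Y)"

definition inverse_algebraic_maps ::
    "'a::field mpoly csys \<Rightarrow> 'a mpoly csys \<Rightarrow> 'a fracs \<Rightarrow> 'a fracs \<Rightarrow> bool" where
  "inverse_algebraic_maps X Y F G \<longleftrightarrow>
     algebraic_map X Y F \<and> algebraic_map Y X G \<and>
     (\<forall>x\<in>points X. fracs_apply (nvars X) G (fracs_apply (nvars Y) F x) = x) \<and>
     (\<forall>y\<in>points Y. fracs_apply (nvars Y) F (fracs_apply (nvars X) G y) = y)"

definition algebraic_iso :: "'a::field mpoly csys \<Rightarrow> 'a mpoly csys \<Rightarrow> 'a fracs \<Rightarrow> bool" where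
  "algebraic_iso X Y F \<longleftrightarrow> (\<exists>G. inverse_algebraic_maps X Y F G)"


section \<open>The Grothendieck group of real varieties\<close>

text \<open>Systems are here regarded as reduced varieties over the reals. Such a variety is affine and
  is determined by its complex points, so its morphisms are given by real fractions whose
  denominators vanish at no complex point.\<close>

definition isomorphic_over_R :: "real mpoly csys \<Rightarrow> real mpoly csys \<Rightarrow> bool" where
  "isomorphic_over_R X Y \<longleftrightarrow>
     (\<exists>F G. inverse_algebraic_maps (complexify X) (complexify Y)
              (complexify_fracs F) (complexify_fracs G))"

definition closed_subvariety :: "real mpoly csys \<Rightarrow> real mpoly csys \<Rightarrow> bool" where
  "closed_subvariety Y X \<longleftrightarrow> nvars Y = nvars X \<and>
     (\<exists>P. set P \<subseteq> polys (nvars X) \<and>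
        points (complexify Y) =
          {x \<in> points (complexify X). \<forall>p\<in>set P. peval (complexify_poly p) x = 0})"

definition is_complement :: "real mpoly csys \<Rightarrow> real mpoly csys \<Rightarrow> real mpoly csys \<Rightarrow> bool" where
  "is_complement U X Y \<longleftrightarrow> nvars U = nvars X \<and>
     points (complexify U) = points (complexify X) - points (complexify Y)"

text \<open>The free abelian group on \<open>'x\<close>.\<close>

type_synonym 'x frag = "'x \<Rightarrow>\<^sub>0 int"

text \<open>The last set of relations discards the generators that do not present a variety.\<close>

definition K0_relations :: "real mpoly csys frag set" where
  "K0_relations =
     {frag_of X - frag_of Y | X Y. wf_csys X \<and> wf_csys Y \<and> isomorphic_over_R X Y} \<union>
     {frag_of X - (frag_of Y + frag_of U) | X Y U.
        wf_csys X \<and> wf_csys Y \<and> wf_csys U \<and> closed_subvariety Y X \<and> is_complement U X Y} \<union>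
     {frag_of X | X. \<not> wf_csys X}"

lemma equivp_group_closure: "equivp (\<lambda>s t. s - t \<in> group_closure S)"
proof (rule equivpI)
  show "reflp (\<lambda>s t. s - t \<in> group_closure S)"
    by (simp add: reflp_def)
  show "symp (\<lambda>s t. s - t \<in> group_closure S)"
    by (rule sympI) (metis group_closure_minus_iff minus_diff_eq)
  show "transp (\<lambda>s t. s - t \<in> group_closure S)"
  proof (rule transpI)
    fix s t u
    assume "s - t \<in> group_closure S" "t - u \<in> group_closure S"
    from group_closure_add[OF this] show "s - u \<in> group_closure S" by simp
  qed
qed

lemma group_closure_cong_add:
  assumes "s - t \<in> group_closure S" "u - v \<in> group_closure S"
  shows "(s + u) - (t + v) \<in> group_closure S"
  using group_closure_add[OF assms] by (simp add: algebra_simps)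

lemma group_closure_cong_diff:
  assumes "s - t \<in> group_closure S" "u - v \<in> group_closure S"
  shows "(s - u) - (t - v) \<in> group_closure S"
  using group_closure.diff[OF assms] by (simp add: algebra_simps)

lemma group_closure_cong_uminus:
  assumes "s - t \<in> group_closure S"
  shows "- s - (- t) \<in> group_closure S"
  using group_closure_cong_diff[of 0 0, OF _ assms] by simp

quotient_type K0 = "real mpoly csys frag" / "\<lambda>s t. s - t \<in> group_closure K0_relations"
  by (rule equivp_group_closure)

instantiation K0 :: ab_group_add
begin

lift_definition zero_K0 :: K0 is 0 .
lift_definition plus_K0 :: "K0 \<Rightarrow> K0 \<Rightarrow> K0" is "(+)" by (rule group_closure_cong_add)
lift_definition minus_K0 :: "K0 \<Rightarrow> K0 \<Rightarrow> K0" is "(-)" by (rule group_closure_cong_diff)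
lift_definition uminus_K0 :: "K0 \<Rightarrow> K0" is uminus by (rule group_closure_cong_uminus)

instance by standard (transfer; simp add: algebra_simps)+

end

definition class_of :: "real mpoly csys \<Rightarrow> K0" where
  "class_of X = abs_K0 (frag_of X)"


section \<open>Tensor products of abelian groups\<close>

definition bilinear_relations :: "('a::ab_group_add \<times> 'b::ab_group_add) frag set" where
  "bilinear_relations =
     {frag_of (a + a', b) - (frag_of (a, b) + frag_of (a', b)) | a a' b. True} \<union>
     {frag_of (a, b + b') - (frag_of (a, b) + frag_of (a, b')) | a b b'. True}"

quotient_type (overloaded) ('a, 'b) tensor =
    "('a::ab_group_add \<times> 'b::ab_group_add) frag" /
    "\<lambda>s t. s - t \<in> group_closure bilinear_relations"
  by (rule equivp_group_closure)

instantiation tensor :: (ab_group_add, ab_group_add) ab_group_add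
begin

lift_definition zero_tensor :: "('a, 'b) tensor" is 0 .
lift_definition plus_tensor :: "('a, 'b) tensor \<Rightarrow> ('a, 'b) tensor \<Rightarrow> ('a, 'b) tensor"
  is "(+)" by (rule group_closure_cong_add)
lift_definition minus_tensor :: "('a, 'b) tensor \<Rightarrow> ('a, 'b) tensor \<Rightarrow> ('a, 'b) tensor"
  is "(-)" by (rule group_closure_cong_diff)
lift_definition uminus_tensor :: "('a, 'b) tensor \<Rightarrow> ('a, 'b) tensor"
  is uminus by (rule group_closure_cong_uminus)

instance by standard (transfer; simp add: algebra_simps)+

end

lift_definition pure_tensor :: "'a::ab_group_add \<Rightarrow> 'b::ab_group_add \<Rightarrow> ('a, 'b) tensor"
  is "\<lambda>a b. frag_of (a, b)" .

lemma frag_extend_group_closure: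
  assumes "\<And>r. r \<in> S \<Longrightarrow> frag_extend f r \<in> group_closure T" "s \<in> group_closure S"
  shows "frag_extend f s \<in> group_closure T"
  using assms(2)
proof induction
  case (base s)
  then show ?case using assms(1) by auto
next
  case (diff s t)
  then show ?case by (simp add: frag_extend_diff group_closure.diff)
qed

lemma frag_extend_scale_bilinear:
  assumes "r \<in> bilinear_relations"
  shows "frag_extend (\<lambda>(a, b). frag_of (a, c * b)) r \<in>
    group_closure (bilinear_relations :: ('a::ab_group_add \<times> 'b::comm_ring) frag set)"
proof -
  have "frag_extend (\<lambda>(a, b). frag_of (a, c * b)) r \<in>
      (bilinear_relations :: ('a \<times> 'b) frag set)"
    using assms unfolding bilinear_relations_def
    by (simp add: frag_extend_diff frag_extend_add distrib_left) (elim disjE exE; fastforce simp: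
        frag_extend_diff frag_extend_add distrib_left)
  then show ?thesis by (simp add: group_closure.base)
qed

text \<open>The scalar action \<open>c \<cdot> (a \<otimes> b) = a \<otimes> (c b)\<close>.\<close>

lift_definition scale :: "'b::comm_ring \<Rightarrow> ('a::ab_group_add, 'b) tensor \<Rightarrow> ('a, 'b) tensor"
  is "\<lambda>c. frag_extend (\<lambda>(a, b). frag_of (a, c * b))"
  by (simp flip: frag_extend_diff add: frag_extend_group_closure[OF frag_extend_scale_bilinear])


section \<open>The ring of dyadic rationals\<close>

typedef dyadic = "{q::rat. \<exists>a n. q = of_int a / 2 ^ n}"
  by auto

setup_lifting type_definition_dyadic

instantiation dyadic :: comm_ring_1
begin

lift_definition zero_dyadic :: dyadic is 0
  by (rule exI[of _ 0]) simp
lift_definition one_dyadic :: dyadic is 1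
  by (rule exI[of _ 1], rule exI[of _ 0]) simp
lift_definition plus_dyadic :: "dyadic \<Rightarrow> dyadic \<Rightarrow> dyadic" is "(+)"
proof -
  fix p q :: rat
  assume "\<exists>a n. p = of_int a / 2 ^ n" "\<exists>a n. q = of_int a / 2 ^ n"
  then obtain a m b n where "p = of_int a / 2 ^ m" "q = of_int b / 2 ^ n" by blast
  then have "p + q = of_int (a * 2 ^ n + b * 2 ^ m) / 2 ^ (m + n)"
    by (simp add: power_add add_divide_distrib diff_divide_distrib)
  then show "\<exists>a n. p + q = of_int a / 2 ^ n" by blast
qed
lift_definition uminus_dyadic :: "dyadic \<Rightarrow> dyadic" is uminus
proof -
  fix q :: rat
  assume "\<exists>a n. q = of_int a / 2 ^ n"
  then obtain a n where "q = of_int a / 2 ^ n" by blast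
  then have "- q = of_int (- a) / 2 ^ n" by simp
  then show "\<exists>a n. - q = of_int a / 2 ^ n" by blast
qed
lift_definition minus_dyadic :: "dyadic \<Rightarrow> dyadic \<Rightarrow> dyadic" is "(-)"
proof -
  fix p q :: rat
  assume "\<exists>a n. p = of_int a / 2 ^ n" "\<exists>a n. q = of_int a / 2 ^ n"
  then obtain a m b n where "p = of_int a / 2 ^ m" "q = of_int b / 2 ^ n" by blast
  then have "p - q = of_int (a * 2 ^ n - b * 2 ^ m) / 2 ^ (m + n)"
    by (simp add: power_add add_divide_distrib diff_divide_distrib)
  then show "\<exists>a n. p - q = of_int a / 2 ^ n" by blast
qed
lift_definition times_dyadic :: "dyadic \<Rightarrow> dyadic \<Rightarrow> dyadic" is "(*)"
proof -
  fix p q :: rat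
  assume "\<exists>a n. p = of_int a / 2 ^ n" "\<exists>a n. q = of_int a / 2 ^ n"
  then obtain a m b n where "p = of_int a / 2 ^ m" "q = of_int b / 2 ^ n" by blast
  then have "p * q = of_int (a * b) / 2 ^ (m + n)"
    by (simp add: power_add)
  then show "\<exists>a n. p * q = of_int a / 2 ^ n" by blast
qed

instance by standard (transfer; simp add: algebra_simps)+

end

lift_definition half :: dyadic is "1 / 2"
  by (rule exI[of _ 1], rule exI[of _ 1]) simp

type_synonym K0_half = "(K0, dyadic) tensor"


section \<open>Basic semialgebraic formulas\<close>

text \<open>The formula given by the system \<open>base\<close> together with \<open>R > 0\<close> for \<open>R\<close> in \<open>ineqs\<close>.\<close>

datatype formula = Formula (base: "real mpoly csys") (ineqs: "real mpoly list")

definition wf_formula :: "formula \<Rightarrow> bool" where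
  "wf_formula A \<longleftrightarrow> wf_csys (base A) \<and> set (ineqs A) \<subseteq> polys (nvars (base A))"

definition with_root :: "'a::comm_ring_1 mpoly csys \<Rightarrow> 'a mpoly \<Rightarrow> 'a mpoly csys" where
  "with_root X R = CSys (Suc (nvars X)) ((Var (nvars X) ^ 2 - R) # eqs X) (neqs X)"

definition with_neq :: "'p csys \<Rightarrow> 'p \<Rightarrow> 'p csys" where
  "with_neq X R = CSys (nvars X) (eqs X) (R # neqs X)"

fun chi_aux :: "real mpoly csys \<Rightarrow> real mpoly list \<Rightarrow> K0_half" where
  "chi_aux X [] = pure_tensor (class_of X) 1"
| "chi_aux X (R # Rs) =
     scale (half * half) (chi_aux (with_root X R) Rs - chi_aux (with_root X (- R)) Rs) +
     scale half (chi_aux (with_neq X R) Rs)"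

definition chi :: "formula \<Rightarrow> K0_half" where
  "chi A = chi_aux (base A) (ineqs A)"


section \<open>Isomorphism of formulas\<close>

text \<open>The constructible set obtained by adjoining a square root \<open>Y\<^sub>j\<close> of each \<open>R\<^sub>j\<close>; the variable
  \<open>Y\<^sub>j\<close> (\<open>j < r\<close>) has index \<open>n + j\<close>.\<close>

definition double_cover :: "formula \<Rightarrow> real mpoly csys" where
  "double_cover A = (let n = nvars (base A); r = length (ineqs A) in
     CSys (n + r) (eqs (base A) @ map (\<lambda>j. Var (n + j) ^ 2 - ineqs A ! j) [0..<r])
       (neqs (base A)))"

definition sign_action :: "nat \<Rightarrow> nat \<Rightarrow> (nat \<Rightarrow> 'a::field) \<Rightarrow> (nat \<Rightarrow> 'a) \<Rightarrow> nat \<Rightarrow> 'a" where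
  "sign_action n r \<epsilon> x = (\<lambda>i. if n \<le> i \<and> i < n + r then \<epsilon> (i - n) * x i else x i)"

definition equivariant :: "nat \<Rightarrow> nat \<Rightarrow> 'a::field mpoly csys \<Rightarrow> 'a mpoly csys \<Rightarrow> 'a fracs \<Rightarrow> bool" where
  "equivariant n r V W F \<longleftrightarrow>
     (\<forall>\<epsilon>. (\<forall>j<r. \<epsilon> j \<in> {1, -1}) \<longrightarrow>
        (\<forall>x\<in>points V. fracs_apply (nvars W) F (sign_action n r \<epsilon> x) =
                        sign_action n r \<epsilon> (fracs_apply (nvars W) F x)))"

text \<open>Equivariance is also required on complex points, that is, of the morphism of varieties over
  the reals: when the cover has few real points it does not follow from equivariance there.\<close>

definition isomorphic_formulas :: "formula \<Rightarrow> formula \<Rightarrow> bool" where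
  "isomorphic_formulas A B \<longleftrightarrow>
     nvars (base A) = nvars (base B) \<and> length (ineqs A) = length (ineqs B) \<and>
     (let n = nvars (base A); r = length (ineqs A); V = double_cover A; W = double_cover B in
      \<exists>\<phi>. algebraic_iso V W \<phi> \<and> equivariant n r V W \<phi> \<and>
          algebraic_iso (complexify V) (complexify W) (complexify_fracs \<phi>) \<and>
          equivariant n r (complexify V) (complexify W) (complexify_fracs \<phi>))"

end

theory Submission
  imports Defs
begin

text \<open>
  Write \<open>Y\<^sub>1, \<dots>, Y\<^sub>r\<close> for the adjoined square roots. Unfolding the recursion, \<open>\<chi>(A)\<close> is a combination,
  with coefficients that depend on \<open>r\<close> only, of the classes of the sets obtained from the base of
  \<open>A\<close> by imposing, for each \<open>j\<close>, one of the conditions \<open>Y\<^sub>j\<^sup>2 = R\<^sub>j\<close>, \<open>Y\<^sub>j\<^sup>2 = - R\<^sub>j\<close> or \<open>R\<^sub>j \<noteq> 0\<close>. The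
  corresponding sets for \<open>A\<close> and \<open>B\<close> turn out to be isomorphic one by one.

  A set with \<open>Y\<^sub>j\<^sup>2 = - R\<^sub>j\<close> is a twisted form of one with \<open>Y\<^sub>j\<^sup>2 = R\<^sub>j\<close>, and a set with \<open>R\<^sub>j \<noteq> 0\<close> is
  the quotient of the part \<open>Y\<^sub>j \<noteq> 0\<close> of such a set by the sign change of \<open>Y\<^sub>j\<close>. Both are handled by bringing the equivariant isomorphism into a normal
  form. A function that is regular on the complex points of the double cover and invariant under
  all sign changes is a regular function on the base, and one that changes sign with \<open>Y\<^sub>j\<close> alone
  is \<open>Y\<^sub>j\<close> times a regular function on the base (\<open>semi_invariant_regular\<close>). The components of an
  equivariant map are of these two kinds, hence \<open>\<phi>(x, y) = (F(x), y\<^sub>1 h\<^sub>1(x), \<dots>, y\<^sub>r h\<^sub>r(x))\<close>, and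
  likewise the inverse is given by some \<open>G\<close> and \<open>k\<^sub>j\<close>. It follows that \<open>F\<close> and \<open>G\<close> are inverse
  isomorphisms of the bases, that \<open>S\<^sub>j(F(x)) = R\<^sub>j(x) h\<^sub>j(x)\<^sup>2\<close>, and that \<open>h\<^sub>j(x) k\<^sub>j(F(x)) = 1\<close> wherever
  \<open>R\<^sub>j(x) \<noteq> 0\<close> (\<open>regular_iso_if_equivariant_iso\<close>). These relations are unchanged when \<open>R\<^sub>j\<close> and \<open>S\<^sub>j\<close>
  are both negated, and they show that the same formula \<open>(x, y) \<mapsto> (F(x), y\<^sub>j h\<^sub>j(x))\<close> is an isomorphism
  between any two corresponding sets (\<open>chi_aux_eq_if_square_equiv\<close>).

  An isomorphism of varieties over the reals needs fractions with real coefficients in both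
  directions, whereas the inverse of \<open>\<phi>\<^sub>\<complex>\<close> is only given with complex ones. But \<open>\<phi>\<^sub>\<complex>\<close> commutes
  with complex conjugation, hence so does its inverse, and a fraction that commutes with conjugation
  can be rewritten with real coefficients (\<open>regular_if_commutes_with_cnj\<close>).
\<close>

section \<open>Evaluation of polynomials\<close>

lemma update_eq_add_single:
  "a \<notin> Poly_Mapping.keys f \<Longrightarrow> Poly_Mapping.update a b f = f + Poly_Mapping.single a b"
  for f :: "'k \<Rightarrow>\<^sub>0 'v::monoid_add"
  by (intro poly_mapping_eqI) (auto simp: lookup_update lookup_add lookup_single when_def in_keys_iff)

lemma poly_mapping_monomial_induct [case_names zero single add]:
  assumes "P 0" and "\<And>k v. P (Poly_Mapping.single k v)" and "\<And>p q. P p \<Longrightarrow> P q \<Longrightarrow> P (p + q)"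
  shows "P (p :: 'k \<Rightarrow>\<^sub>0 'v::monoid_add)"
proof (induction p rule: Poly_Mapping.update_induct)
  case const
  then show ?case by (rule assms(1))
next
  case (update f a b)
  then show ?case using assms by (simp add: update_eq_add_single)
qed

definition monomial_value :: "(nat \<Rightarrow> 'a::comm_semiring_1) \<Rightarrow> (nat \<Rightarrow>\<^sub>0 nat) \<Rightarrow> 'a" where
  "monomial_value x m = (\<Prod>i\<in>Poly_Mapping.keys m. x i ^ Poly_Mapping.lookup m i)"

lemma monomial_value_superset:
  assumes "finite I" "Poly_Mapping.keys m \<subseteq> I"
  shows "monomial_value x m = (\<Prod>i\<in>I. x i ^ Poly_Mapping.lookup m i)"
  unfolding monomial_value_def
  by (rule prod.mono_neutral_left) (use assms in \<open>auto simp: in_keys_iff\<close>)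

lemma monomial_value_add: "monomial_value x (k + l) = monomial_value x k * monomial_value x l"
proof -
  let ?I = "Poly_Mapping.keys k \<union> Poly_Mapping.keys l"
  have "finite ?I" by simp
  note * = monomial_value_superset[OF this]
  show ?thesis
    by (subst (1 2 3) *)
       (use keys_add[of k l] in \<open>auto simp: lookup_add power_add prod.distrib\<close>)
qed

lemma monomial_value_zero [simp]: "monomial_value x 0 = 1"
  by (simp add: monomial_value_def)

lemma peval_conv_monomial_value:
  "peval p x = (\<Sum>m\<in>Poly_Mapping.keys p. Poly_Mapping.lookup p m * monomial_value x m)"
  by (simp add: peval_def monomial_value_def)

lemma peval_zero [simp]: "peval 0 x = 0"
  by (simp add: peval_def)

lemma peval_single: "peval (Poly_Mapping.single m c) x = c * monomial_value x m"
  by (cases "c = 0") (simp_all add: peval_conv_monomial_value)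

lemma peval_Var [simp]: "peval (Var i) x = x i"
  by (simp add: Var_def peval_single monomial_value_def lookup_single)

lemma peval_add [simp]: "peval (p + q) x = peval p x + peval q x"
  unfolding peval_conv_monomial_value
  by (rule setsum_keys_plus_distrib) (simp_all add: distrib_right)

lemma peval_mult [simp]: "peval (p * q) x = peval p x * peval q x"
proof (induction p rule: poly_mapping_monomial_induct)
  case (single k v)
  show ?case
    by (induction q rule: poly_mapping_monomial_induct)
       (simp_all add: mult_single peval_single monomial_value_add algebra_simps)
qed (simp_all add: algebra_simps)

lemma complexify_poly_zero [simp]: "complexify_poly 0 = 0"
  unfolding complexify_poly_def by transfer auto

lemma lookup_complexify_poly [simp]:
  "Poly_Mapping.lookup (complexify_poly p) m = of_real (Poly_Mapping.lookup p m)"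
  by (simp add: complexify_poly_def map.rep_eq when_def)

lemma keys_complexify_poly [simp]: "Poly_Mapping.keys (complexify_poly p) = Poly_Mapping.keys p"
  by (auto simp: in_keys_iff)

lemma complexify_poly_single [simp]:
  "complexify_poly (Poly_Mapping.single m c) = Poly_Mapping.single m (of_real c)"
  by (rule poly_mapping_eqI) (simp add: lookup_single when_def)

lemma complexify_poly_Var [simp]: "complexify_poly (Var i) = Var i"
  by (simp add: Var_def)

lemma complexify_poly_add [simp]: "complexify_poly (p + q) = complexify_poly p + complexify_poly q"
  by (rule poly_mapping_eqI) (simp add: lookup_add)

lemma complexify_poly_mult [simp]: "complexify_poly (p * q) = complexify_poly p * complexify_poly q"
proof (induction p rule: poly_mapping_monomial_induct)
  case (single k v)
  show ?case
    by (induction q rule: poly_mapping_monomial_induct)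
       (simp_all add: mult_single algebra_simps)
qed (simp_all add: algebra_simps)

text \<open>Real systems are studied through their complex points, where only real polynomials are ever
  evaluated; this is the evaluation map for them.\<close>

definition ceval :: "real mpoly \<Rightarrow> (nat \<Rightarrow> complex) \<Rightarrow> complex" where
  "ceval p x = peval (complexify_poly p) x"

abbreviation const :: "'a \<Rightarrow> 'a::comm_semiring_1 mpoly" where
  "const c \<equiv> Poly_Mapping.single 0 c"

lemma ceval_add [simp]: "ceval (p + q) x = ceval p x + ceval q x"
  and ceval_mult [simp]: "ceval (p * q) x = ceval p x * ceval q x"
  and ceval_const [simp]: "ceval (const c) x = of_real c"
  and ceval_Var [simp]: "ceval (Var i) x = x i"
  by (simp_all add: ceval_def peval_single)

lemma ceval_uminus [simp]: "ceval (- p) x = - ceval p x"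
proof -
  have "ceval (- p) x + ceval p x = ceval (- p + p) x" by (simp only: ceval_add)
  also have "\<dots> = 0" by (simp add: ceval_def)
  finally show ?thesis by (simp add: add_eq_0_iff2)
qed

lemma ceval_diff [simp]: "ceval (p - q) x = ceval p x - ceval q x"
  using ceval_add[of p "- q" x] by simp

lemma ceval_zero [simp]: "ceval 0 x = 0"
  by (simp add: ceval_def)

lemma ceval_one [simp]: "ceval 1 x = 1"
  using ceval_const[of 1 x] by simp

lemma ceval_power2 [simp]: "ceval (p\<^sup>2) x = (ceval p x)\<^sup>2"
  by (simp add: power2_eq_square)

lemma ceval_cnj: "ceval p (cnj \<circ> x) = cnj (ceval p x)"
  by (simp add: ceval_def peval_def)

lemma ceval_cong:
  assumes "p \<in> polys n" "\<And>i. i < n \<Longrightarrow> x i = y i"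
  shows "ceval p x = ceval p y"
  unfolding ceval_def peval_def keys_complexify_poly
  using assms by (intro sum.cong arg_cong2[where f = "(*)"] arg_cong2[where f = "(^)"] prod.cong refl)
    (auto simp: polys_def)

lemma peval_real_imaginary_parts:
  fixes p :: "complex mpoly"
  assumes "p \<in> polys n"
  shows "\<exists>a\<in>polys n. \<exists>b\<in>polys n. \<forall>x. peval p x = ceval a x + \<i> * ceval b x"
proof -
  let ?a = "Poly_Mapping.map Re p" and ?b = "Poly_Mapping.map Im p"
  have "Poly_Mapping.keys (Poly_Mapping.map f p) \<subseteq> Poly_Mapping.keys p" for f :: "complex \<Rightarrow> real"
    by (auto simp: in_keys_iff map.rep_eq)
  then have polys: "?a \<in> polys n" "?b \<in> polys n"
    using assms unfolding polys_def by blast+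
  have "p = complexify_poly ?a + const \<i> * complexify_poly ?b"
  proof (induction p rule: poly_mapping_monomial_induct)
    case zero
    have "Poly_Mapping.map f (0 :: complex mpoly) = 0" for f :: "complex \<Rightarrow> real"
      by (rule poly_mapping_eqI) (simp add: map.rep_eq)
    then show ?case by simp
  next
    case (single k v)
    have m: "Poly_Mapping.map f (Poly_Mapping.single k v) = Poly_Mapping.single k (f v)"
      if "f 0 = 0" for f :: "complex \<Rightarrow> real"
      using that by (intro poly_mapping_eqI) (auto simp: map.rep_eq lookup_single when_def)
    show ?case by (simp add: m mult_single complex_eq[symmetric] flip: single_add)
  next
    case (add p q)
    have "Poly_Mapping.lookup (Poly_Mapping.map f r) k = f (Poly_Mapping.lookup r k)"
      if "f 0 = 0" for f :: "complex \<Rightarrow> real" and r :: "complex mpoly" and k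
      using that by (simp add: map.rep_eq when_def)
    then have m: "Poly_Mapping.map f (p + q) = Poly_Mapping.map f p + Poly_Mapping.map f q"
      if "f 0 = 0" "\<And>x y. f (x + y) = f x + f y" for f :: "complex \<Rightarrow> real"
      using that by (intro poly_mapping_eqI) (simp add: lookup_add)
    from add show ?case by (simp add: m algebra_simps)
  qed
  then have "peval p x = ceval ?a x + \<i> * ceval ?b x" for x
    by (metis ceval_def peval_add peval_mult peval_single monomial_value_zero mult_1_right)
  with polys show ?thesis by blast
qed

lemma polys_add [intro]: "p \<in> polys n \<Longrightarrow> q \<in> polys n \<Longrightarrow> p + q \<in> polys n"
  using keys_add[of p q] by (auto simp: polys_def)

lemma polys_mult [intro]:
  assumes "p \<in> polys n" "q \<in> polys n"
  shows "p * q \<in> polys n"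
proof -
  have "Poly_Mapping.keys m \<subseteq> {..<n}" if m: "m \<in> Poly_Mapping.keys (p * q)" for m
  proof -
    obtain a b where "m = a + b" "a \<in> Poly_Mapping.keys p" "b \<in> Poly_Mapping.keys q"
      using m keys_mult[of p q] by blast
    with assms keys_add[of a b] show ?thesis unfolding polys_def by blast
  qed
  then show ?thesis by (simp add: polys_def)
qed

lemma polys_uminus [intro]: "p \<in> polys n \<Longrightarrow> - p \<in> polys n"
  for p :: "'a::comm_ring_1 mpoly"
  by (simp add: polys_def in_keys_iff)

lemma polys_diff [intro]: "p \<in> polys n \<Longrightarrow> q \<in> polys n \<Longrightarrow> p - q \<in> polys n"
  for p :: "'a::comm_ring_1 mpoly"
  using polys_add[of p n "- q"] by auto

lemma polys_const [intro]: "const c \<in> polys n"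
  by (auto simp: polys_def)

lemma polys_zero [simp]: "0 \<in> polys n"
  by (simp add: polys_def)

lemma polys_one [intro]: "1 \<in> polys n"
  using polys_const[of 1 n] by simp

lemma polys_Var [intro]: "i < n \<Longrightarrow> Var i \<in> polys n"
  by (auto simp: polys_def Var_def)

lemma polys_power2 [intro]: "p \<in> polys n \<Longrightarrow> p\<^sup>2 \<in> polys n"
  by (auto simp: power2_eq_square)

lemma polys_mono: "p \<in> polys n \<Longrightarrow> n \<le> k \<Longrightarrow> p \<in> polys k"
  by (force simp: polys_def)

lemma polys_complexify [simp]: "complexify_poly p \<in> polys n \<longleftrightarrow> p \<in> polys n"
  by (simp add: polys_def)

text \<open>The polynomials in the first \<open>n\<close> variables are generated by constants and variables, so a
  property of the induced functions that is stable under ring operations holds for all of them.\<close>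

lemma polys_induct [consumes 1, case_names const Var add mult]:
  assumes "p \<in> polys n"
    and const: "\<And>c. P (const c)" and Var: "\<And>i. i < n \<Longrightarrow> P (Var i)"
    and add: "\<And>p q. P p \<Longrightarrow> P q \<Longrightarrow> P (p + q)" and mult: "\<And>p q. P p \<Longrightarrow> P q \<Longrightarrow> P (p * q)"
  shows "P (p :: 'a::comm_semiring_1 mpoly)"
proof -
  have power: "P (Poly_Mapping.single (Poly_Mapping.single i e) 1)" if "i < n" for i e
  proof (induction e)
    case 0
    then show ?case using const[of 1] by simp
  next
    case (Suc e)
    have "Poly_Mapping.single (Poly_Mapping.single i (Suc e)) (1::'a) =
        Var i * Poly_Mapping.single (Poly_Mapping.single i e) 1"
      by (simp add: Var_def mult_single flip: single_add)
    then show ?case using Suc mult Var that by simp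
  qed
  have monom: "P (Poly_Mapping.single m 1)" if "Poly_Mapping.keys m \<subseteq> {..<n}" for m
    using that
  proof (induction m rule: Poly_Mapping.update_induct)
    case const
    then show ?case using assms(2)[of 1] by simp
  next
    case (update m i e)
    note * = update_eq_add_single[OF update(1)]
    have "Poly_Mapping.keys m \<subseteq> Poly_Mapping.keys (Poly_Mapping.update i e m)"
      "i \<in> Poly_Mapping.keys (Poly_Mapping.update i e m)"
      using update(1,2) by (auto simp: in_keys_iff lookup_update)
    then have "P (Poly_Mapping.single m 1 * Poly_Mapping.single (Poly_Mapping.single i e) 1)"
      using update(3,4) power[of i e] mult by blast
    then show ?case by (simp add: * mult_single)
  qed
  show ?thesis
    using assms(1)
  proof (induction p rule: Poly_Mapping.update_induct)
    case const
    then show ?case using assms(2)[of 0] by simp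
  next
    case (update p m c)
    have *: "Poly_Mapping.update m c p = p + const c * Poly_Mapping.single m 1"
      by (simp add: update_eq_add_single[OF update(1)] mult_single)
    have "Poly_Mapping.keys p \<subseteq> Poly_Mapping.keys (Poly_Mapping.update m c p)"
      "m \<in> Poly_Mapping.keys (Poly_Mapping.update m c p)"
      using update(1,2) by (auto simp: in_keys_iff lookup_update)
    then have "p \<in> polys n" "Poly_Mapping.keys m \<subseteq> {..<n}"
      using update(4) by (auto simp: polys_def)
    then show ?case
      unfolding * using update(3) monom assms(2) add mult by blast
  qed
qed

section \<open>Regular functions with real coefficients\<close>

text \<open>The morphisms in the Grothendieck group have coordinates of this form. Speaking of functions
  on complex points instead of pairs of polynomials leaves the choice of fractions to the proofs.\<close>

definition regular :: "nat \<Rightarrow> (nat \<Rightarrow> complex) set \<Rightarrow> ((nat \<Rightarrow> complex) \<Rightarrow> complex) \<Rightarrow> bool" where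
  "regular n S f \<longleftrightarrow>
     (\<exists>p\<in>polys n. \<exists>q\<in>polys n. \<forall>x\<in>S. ceval q x \<noteq> 0 \<and> f x = ceval p x / ceval q x)"

lemma regularI:
  assumes "p \<in> polys n" "q \<in> polys n"
    and "\<And>x. x \<in> S \<Longrightarrow> ceval q x \<noteq> 0" "\<And>x. x \<in> S \<Longrightarrow> f x = ceval p x / ceval q x"
  shows "regular n S f"
  using assms unfolding regular_def by blast

lemma regularE:
  assumes "regular n S f"
  obtains p q where "p \<in> polys n" "q \<in> polys n"
    "\<And>x. x \<in> S \<Longrightarrow> ceval q x \<noteq> 0" "\<And>x. x \<in> S \<Longrightarrow> f x = ceval p x / ceval q x"
  using assms unfolding regular_def by blast

lemma regular_subset: "regular n S f \<Longrightarrow> T \<subseteq> S \<Longrightarrow> regular n T f"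
  unfolding regular_def by blast

lemma regular_coordinate: "i < n \<Longrightarrow> regular n S (\<lambda>x. x i)"
  by (rule regularI[of "Var i" n 1]) auto

lemma regular_mult:
  assumes "regular n S f" "regular n S g"
  shows "regular n S (\<lambda>x. f x * g x)"
proof -
  obtain p q where pq: "p \<in> polys n" "q \<in> polys n"
    "\<And>x. x \<in> S \<Longrightarrow> ceval q x \<noteq> 0" "\<And>x. x \<in> S \<Longrightarrow> f x = ceval p x / ceval q x"
    using assms(1) by (elim regularE) blast
  obtain p' q' where pq': "p' \<in> polys n" "q' \<in> polys n"
    "\<And>x. x \<in> S \<Longrightarrow> ceval q' x \<noteq> 0" "\<And>x. x \<in> S \<Longrightarrow> g x = ceval p' x / ceval q' x"
    using assms(2) by (elim regularE) blast
  show ?thesis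
    by (rule regularI[of "p * p'" n "q * q'"]) (use pq pq' in auto)
qed

lemma regular_drop_coordinate:
  assumes "regular n S f" "\<And>x. x \<in> T \<Longrightarrow> x(n := 0) \<in> S"
  shows "regular (Suc n) T (\<lambda>x. f (x(n := 0)))"
proof -
  obtain p q where pq: "p \<in> polys n" "q \<in> polys n"
    "\<And>x. x \<in> S \<Longrightarrow> ceval q x \<noteq> 0" "\<And>x. x \<in> S \<Longrightarrow> f x = ceval p x / ceval q x"
    using assms(1) by (elim regularE) blast
  have c: "ceval r (x(n := 0)) = ceval r x" if "r \<in> polys n" for r x
    using that by (rule ceval_cong) simp
  show ?thesis
  proof (rule regularI[of p "Suc n" q])
    show "p \<in> polys (Suc n)" "q \<in> polys (Suc n)"
      using pq(1,2) by (auto intro: polys_mono)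
    show "ceval q x \<noteq> 0" "f (x(n := 0)) = ceval p x / ceval q x" if "x \<in> T" for x
      using pq(3,4)[OF assms(2)[OF that]] pq(1,2) by (simp_all add: c)
  qed
qed

text \<open>Galois descent for fractions. With \<open>f = (a + \<i> b) / (c + \<i> d)\<close> and \<open>a, b, c, d\<close> real, conjugation
  gives \<open>f = (a - \<i> b) / (c - \<i> d)\<close> at the same point. Adding and subtracting the two equations yields
  \<open>f c = a\<close> and \<open>f d = b\<close>, whence \<open>f = (a c + b d) / (c\<^sup>2 + d\<^sup>2)\<close>; the new denominator is the product
  of the two old ones.\<close>

lemma regular_if_commutes_with_cnj:
  fixes p q :: "complex mpoly"
  assumes "p \<in> polys n" "q \<in> polys n"
    and frac: "\<And>x. x \<in> S \<Longrightarrow> peval q x \<noteq> 0" "\<And>x. x \<in> S \<Longrightarrow> f x = peval p x / peval q x"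
    and cnj: "\<And>x. x \<in> S \<Longrightarrow> cnj \<circ> x \<in> S" "\<And>x. x \<in> S \<Longrightarrow> f (cnj \<circ> x) = cnj (f x)"
  shows "regular n S f"
proof -
  obtain a b where ab: "a \<in> polys n" "b \<in> polys n" "\<And>x. peval p x = ceval a x + \<i> * ceval b x"
    using peval_real_imaginary_parts[OF assms(1)] by blast
  obtain c d where cd: "c \<in> polys n" "d \<in> polys n" "\<And>x. peval q x = ceval c x + \<i> * ceval d x"
    using peval_real_imaginary_parts[OF assms(2)] by blast
  show ?thesis
  proof (rule regularI[of "a * c + b * d" n "c\<^sup>2 + d\<^sup>2"])
    fix x assume x: "x \<in> S"
    have nz: "ceval c x + \<i> * ceval d x \<noteq> 0"
      using frac(1)[OF x] by (simp add: cd)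
    have "cnj (ceval c x) + \<i> * cnj (ceval d x) \<noteq> 0"
      using frac(1)[OF cnj(1)[OF x]] by (simp add: cd ceval_cnj)
    then have "cnj (cnj (ceval c x) + \<i> * cnj (ceval d x)) \<noteq> 0"
      by (metis complex_cnj_zero_iff)
    then have nz': "ceval c x - \<i> * ceval d x \<noteq> 0"
      by simp
    have "(ceval c x)\<^sup>2 + (ceval d x)\<^sup>2 = (ceval c x + \<i> * ceval d x) * (ceval c x - \<i> * ceval d x)"
      by (simp add: algebra_simps power2_eq_square)
    with nz nz' show nz'': "ceval (c\<^sup>2 + d\<^sup>2) x \<noteq> 0"
      by simp
    have 1: "f x * (ceval c x + \<i> * ceval d x) = ceval a x + \<i> * ceval b x"
      using frac(2)[OF x] nz by (simp add: ab cd)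
    have "cnj (f x) * (cnj (ceval c x) + \<i> * cnj (ceval d x)) = cnj (ceval a x) + \<i> * cnj (ceval b x)"
      using frac[OF cnj(1)[OF x]] by (simp add: cnj(2)[OF x] ab cd ceval_cnj)
    then have "cnj (cnj (f x) * (cnj (ceval c x) + \<i> * cnj (ceval d x))) =
        cnj (cnj (ceval a x) + \<i> * cnj (ceval b x))"
      by (rule arg_cong)
    then have 2: "f x * (ceval c x - \<i> * ceval d x) = ceval a x - \<i> * ceval b x"
      by simp
    \<comment> \<open>The sum and the difference of the facts 1 and 2 separate real and imaginary parts.\<close>
    have c: "2 * (f x * ceval c x) = 2 * ceval a x"
      using arg_cong2[OF 1 2, of "(+)"] by (simp add: algebra_simps)
    have "2 * \<i> * (f x * ceval d x) = 2 * \<i> * ceval b x"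
      using arg_cong2[OF 1 2, of "(-)"] by (simp add: algebra_simps)
    then have d: "f x * ceval d x = ceval b x"
      by simp
    have "f x * ((ceval c x)\<^sup>2 + (ceval d x)\<^sup>2) =
        (f x * ceval c x) * ceval c x + (f x * ceval d x) * ceval d x"
      by (simp add: algebra_simps power2_eq_square)
    also have "\<dots> = ceval a x * ceval c x + ceval b x * ceval d x"
      using c d by simp
    finally show "f x = ceval (a * c + b * d) x / ceval (c\<^sup>2 + d\<^sup>2) x"
      using nz'' by (simp add: field_simps)
  qed (use ab cd in auto)
qed

section \<open>Adjoining one square root\<close>

abbreviation cpoints :: "real mpoly csys \<Rightarrow> (nat \<Rightarrow> complex) set" where
  "cpoints X \<equiv> points (complexify X)"

lemma mem_cpoints:
  "x \<in> cpoints X \<longleftrightarrow> (\<forall>i\<ge>nvars X. x i = 0) \<and> (\<forall>p\<in>set (eqs X). ceval p x = 0) \<and>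
     (\<forall>q\<in>set (neqs X). ceval q x \<noteq> 0)"
  by (simp add: points_def complexify_def ceval_def)

lemma cnj_cpoints: "x \<in> cpoints X \<Longrightarrow> cnj \<circ> x \<in> cpoints X"
  by (simp add: mem_cpoints ceval_cnj)

definition truncate :: "nat \<Rightarrow> (nat \<Rightarrow> complex) \<Rightarrow> nat \<Rightarrow> complex" where
  "truncate n x = (\<lambda>i. if i < n then x i else 0)"

lemma truncate_eqI: "(\<And>i. i \<ge> n \<Longrightarrow> x i = 0) \<Longrightarrow> truncate n x = x"
  by (auto simp: truncate_def fun_eq_iff not_less)

lemma ceval_truncate: "p \<in> polys n \<Longrightarrow> n \<le> k \<Longrightarrow> ceval p (truncate k x) = ceval p x"
  by (rule ceval_cong) (auto simp: truncate_def)

lemma mem_cpoints_with_root: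
  assumes "wf_csys X" "R \<in> polys (nvars X)"
  shows "x \<in> cpoints (with_root X R) \<longleftrightarrow>
    x(nvars X := 0) \<in> cpoints X \<and> (x (nvars X))\<^sup>2 = ceval R (x(nvars X := 0))"
proof -
  have c: "ceval r (x(nvars X := 0)) = ceval r x" if "r \<in> polys (nvars X)" for r
    using that by (rule ceval_cong) simp
  have "(\<forall>i\<ge>nvars X. (x(nvars X := 0)) i = 0) \<longleftrightarrow> (\<forall>i\<ge>Suc (nvars X). x i = 0)"
    by (metis Suc_leD Suc_le_eq fun_upd_apply le_neq_implies_less not_less_eq_eq order_refl)
  moreover have "(\<forall>p\<in>set (eqs X). ceval p (x(nvars X := 0)) = 0) \<longleftrightarrow> (\<forall>p\<in>set (eqs X). ceval p x = 0)"
    "(\<forall>q\<in>set (neqs X). ceval q (x(nvars X := 0)) \<noteq> 0) \<longleftrightarrow> (\<forall>q\<in>set (neqs X). ceval q x \<noteq> 0)"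
    using assms(1) by (simp_all add: wf_csys_def c subset_iff)
  ultimately show ?thesis
    unfolding mem_cpoints with_root_def c[OF assms(2)] by auto
qed

lemma wf_with_root: "wf_csys X \<Longrightarrow> R \<in> polys (nvars X) \<Longrightarrow> wf_csys (with_root X R)"
  by (auto simp: wf_csys_def with_root_def intro!: polys_diff polys_power2 polys_Var intro: polys_mono)

lemma nvars_with_root [simp]: "nvars (with_root X R) = Suc (nvars X)"
  by (simp add: with_root_def)

text \<open>Even powers of the new variable can be replaced by powers of \<open>R\<close>.\<close>

lemma poly_even_odd_parts:
  assumes "p \<in> polys (Suc n)" "R \<in> polys n"
  shows "\<exists>a\<in>polys n. \<exists>b\<in>polys n. \<forall>x. (x n)\<^sup>2 = ceval R x \<longrightarrow> ceval p x = ceval a x + x n * ceval b x"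
  using assms(1)
proof (induction p rule: polys_induct)
  case (const c)
  show ?case by (rule bexI[of _ "const c"], rule bexI[of _ "const 0"]) auto
next
  case (Var i)
  show ?case
  proof (cases "i = n")
    case True
    then show ?thesis by (intro bexI[of _ "const 0"] bexI[of _ "const 1"]) auto
  next
    case False
    with Var have "i < n" by simp
    then show ?thesis by (intro bexI[of _ "Var i"] bexI[of _ "const 0"]) auto
  qed
next
  case (add p q)
  then obtain a b c d where
    "a \<in> polys n" "b \<in> polys n" "\<forall>x. (x n)\<^sup>2 = ceval R x \<longrightarrow> ceval p x = ceval a x + x n * ceval b x"
    "c \<in> polys n" "d \<in> polys n" "\<forall>x. (x n)\<^sup>2 = ceval R x \<longrightarrow> ceval q x = ceval c x + x n * ceval d x"
    by blast
  then show ?case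
    by (intro bexI[of _ "a + c"] bexI[of _ "b + d"]) (auto simp: algebra_simps)
next
  case (mult p q)
  then obtain a b c d where abcd:
    "a \<in> polys n" "b \<in> polys n" "\<forall>x. (x n)\<^sup>2 = ceval R x \<longrightarrow> ceval p x = ceval a x + x n * ceval b x"
    "c \<in> polys n" "d \<in> polys n" "\<forall>x. (x n)\<^sup>2 = ceval R x \<longrightarrow> ceval q x = ceval c x + x n * ceval d x"
    by blast
  show ?case
  proof (intro bexI allI impI)
    fix x :: "nat \<Rightarrow> complex"
    assume sq: "(x n)\<^sup>2 = ceval R x"
    have "ceval (p * q) x = (ceval a x + x n * ceval b x) * (ceval c x + x n * ceval d x)"
      using abcd(3,6) sq by simp
    also have "\<dots> = ceval (a * c + R * (b * d)) x + x n * ceval (a * d + b * c) x"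
      by (simp add: algebra_simps power2_eq_square flip: sq)
    finally show "ceval (p * q) x = \<dots>" .
  qed (use abcd assms(2) in auto)
qed

text \<open>Rationalising the denominator: multiply a fraction \<open>(p\<^sub>0 + y p\<^sub>1) / (q\<^sub>0 + y q\<^sub>1)\<close> by the conjugate
  \<open>q\<^sub>0 - y q\<^sub>1\<close>. The norm \<open>q\<^sub>0\<^sup>2 - R q\<^sub>1\<^sup>2\<close> vanishes at no point of the base, because over the complex numbers
  every such point lifts to the cover, where both factors are values of the original denominator.\<close>

lemma regular_even_odd_parts:
  assumes "wf_csys X" "R \<in> polys (nvars X)"
    and "regular (Suc (nvars X)) (cpoints (with_root X R)) f"
  shows "\<exists>a b. regular (nvars X) (cpoints X) a \<and> regular (nvars X) (cpoints X) b \<and>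
    (\<forall>x\<in>cpoints (with_root X R). f x = a (x(nvars X := 0)) + x (nvars X) * b (x(nvars X := 0)))"
proof -
  let ?n = "nvars X"
  let ?V = "cpoints (with_root X R)"
  note V = mem_cpoints_with_root[OF assms(1,2)]
  obtain p q where pq: "p \<in> polys (Suc ?n)" "q \<in> polys (Suc ?n)"
    "\<And>x. x \<in> ?V \<Longrightarrow> ceval q x \<noteq> 0" "\<And>x. x \<in> ?V \<Longrightarrow> f x = ceval p x / ceval q x"
    using assms(3) by (elim regularE) blast
  have drop: "ceval r (x(?n := y)) = ceval r x" if "r \<in> polys ?n" for r x y
    using that by (rule ceval_cong) simp
  obtain p0 p1 where p: "p0 \<in> polys ?n" "p1 \<in> polys ?n"
    "\<And>x. (x ?n)\<^sup>2 = ceval R x \<Longrightarrow> ceval p x = ceval p0 x + x ?n * ceval p1 x"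
    using poly_even_odd_parts[OF pq(1) assms(2)] by blast
  obtain q0 q1 where q: "q0 \<in> polys ?n" "q1 \<in> polys ?n"
    "\<And>x. (x ?n)\<^sup>2 = ceval R x \<Longrightarrow> ceval q x = ceval q0 x + x ?n * ceval q1 x"
    using poly_even_odd_parts[OF pq(2) assms(2)] by blast
  let ?N = "q0\<^sup>2 - R * q1\<^sup>2" and ?A = "p0 * q0 - R * (p1 * q1)" and ?B = "p1 * q0 - p0 * q1"
  have nz: "ceval q0 s + y * ceval q1 s \<noteq> 0" if "s \<in> cpoints X" "y\<^sup>2 = ceval R s" for s y
  proof -
    have "s(?n := 0) = s" using that(1) by (auto simp: mem_cpoints)
    then have "s(?n := y) \<in> ?V" using that by (simp add: V)
    then show ?thesis
      using pq(3) q(3)[of "s(?n := y)"] that(2) by (auto simp: drop q(1,2) assms(2))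
  qed
  have N: "ceval ?N s = (ceval q0 s + y * ceval q1 s) * (ceval q0 s - y * ceval q1 s)"
    if "y\<^sup>2 = ceval R s" for s y
    by (simp add: that[symmetric] algebra_simps power2_eq_square)
  have N_nz: "ceval ?N s \<noteq> 0" if "s \<in> cpoints X" for s
    using N[of "csqrt (ceval R s)" s] nz[OF that, of "csqrt (ceval R s)"]
      nz[OF that, of "- csqrt (ceval R s)"] by auto
  show ?thesis
  proof (intro exI conjI ballI)
    show "regular ?n (cpoints X) (\<lambda>s. ceval ?A s / ceval ?N s)"
      by (rule regularI[of ?A _ ?N]) (use N_nz p q assms(2) in auto)
    show "regular ?n (cpoints X) (\<lambda>s. ceval ?B s / ceval ?N s)"
      by (rule regularI[of ?B _ ?N]) (use N_nz p q assms(2) in auto)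
  next
    fix x assume x: "x \<in> ?V"
    define s y where "s = x(?n := 0)" and "y = x ?n"
    have s: "s \<in> cpoints X" and y: "y\<^sup>2 = ceval R s"
      using x by (auto simp: V s_def y_def)
    have c: "ceval r x = ceval r s" if "r \<in> polys ?n" for r
      using drop[OF that] by (simp add: s_def)
    have f: "f x = (ceval p0 s + y * ceval p1 s) / (ceval q0 s + y * ceval q1 s)"
      using pq(4)[OF x] p(3)[of x] q(3)[of x] y by (simp add: c p q assms(2) flip: y_def)
    have "f x * ceval ?N s = (ceval p0 s + y * ceval p1 s) * (ceval q0 s - y * ceval q1 s)"
      using nz[OF s y] by (simp only: N[OF y] f) simp
    also have "\<dots> = ceval ?A s + y * ceval ?B s"
      by (simp add: y[symmetric] algebra_simps power2_eq_square)
    finally have fN: "f x * ceval ?N s = ceval ?A s + y * ceval ?B s" .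
    have divide: "z = u / w + y * (v / w)" if "w \<noteq> 0" "z * w = u + y * v" for u v w z :: complex
      using that by (simp add: field_simps)
    show "f x = ceval ?A s / ceval ?N s + x ?n * (ceval ?B s / ceval ?N s)"
      using divide[OF N_nz[OF s] fN] by (simp only: y_def)
  qed
qed

section \<open>Semi-invariant functions on the double cover\<close>

abbreviation cover :: "real mpoly csys \<Rightarrow> real mpoly list \<Rightarrow> (nat \<Rightarrow> complex) set" where
  "cover X Rs \<equiv> cpoints (double_cover (Formula X Rs))"

lemma mem_cover:
  assumes "wf_csys X" "set Rs \<subseteq> polys (nvars X)"
  shows "x \<in> cover X Rs \<longleftrightarrow>
    (\<forall>i\<ge>nvars X + length Rs. x i = 0) \<and> truncate (nvars X) x \<in> cpoints X \<and>
    (\<forall>j<length Rs. (x (nvars X + j))\<^sup>2 = ceval (Rs ! j) (truncate (nvars X) x))"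
proof -
  have c: "ceval r (truncate (nvars X) x) = ceval r x" if "r \<in> polys (nvars X)" for r
    using that by (rule ceval_truncate) simp
  have base: "truncate (nvars X) x \<in> cpoints X \<longleftrightarrow>
      (\<forall>p\<in>set (eqs X). ceval p x = 0) \<and> (\<forall>q\<in>set (neqs X). ceval q x \<noteq> 0)"
    using assms(1) c unfolding mem_cpoints wf_csys_def
    by (simp add: truncate_def[of _ x] subset_iff)
  have roots: "ceval (Rs ! j) (truncate (nvars X) x) = ceval (Rs ! j) x" if "j < length Rs" for j
    using assms(2) nth_mem[OF that] by (intro c) blast
  show ?thesis
    unfolding base unfolding mem_cpoints double_cover_def
    by (auto simp: Let_def roots ball_Un)
qed

lemma truncate_Suc: "(truncate (Suc n) x)(n := 0) = truncate n x"
  by (auto simp: truncate_def fun_eq_iff)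

text \<open>The cover for a list of polynomials arises by adjoining their roots one after the other, in
  the order of the recursion that defines \<open>\<chi>\<close>.\<close>

lemma cover_Cons:
  assumes "wf_csys X" "set (R # Rs) \<subseteq> polys (nvars X)"
  shows "cover X (R # Rs) = cover (with_root X R) Rs"
proof (rule set_eqI)
  fix x
  have R: "R \<in> polys (nvars X)" and Rs: "set Rs \<subseteq> polys (Suc (nvars X))"
    using assms(2) by (auto intro: polys_mono)
  have "ceval (Rs ! j) (truncate (Suc (nvars X)) x) = ceval (Rs ! j) (truncate (nvars X) x)"
    if "j < length Rs" for j
    using that assms(2) nth_mem[OF that] by (intro ceval_cong[of _ "nvars X"]) (auto simp: truncate_def)
  then show "x \<in> cover X (R # Rs) \<longleftrightarrow> x \<in> cover (with_root X R) Rs"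
    using assms R Rs
    by (simp add: mem_cover wf_with_root mem_cpoints_with_root truncate_Suc All_less_Suc2)
       (auto simp: truncate_def)
qed

lemma flip_mem_cover:
  assumes "wf_csys X" "set Rs \<subseteq> polys (nvars X)" "x \<in> cover X Rs" "j < length Rs"
  shows "x(nvars X + j := - x (nvars X + j)) \<in> cover X Rs"
proof -
  have "truncate (nvars X) (x(nvars X + j := - x (nvars X + j))) = truncate (nvars X) x"
    by (auto simp: truncate_def)
  then show ?thesis using assms by (auto simp: mem_cover)
qed

text \<open>Iterating \<open>regular_even_odd_parts\<close>. In the induction step, the factor \<open>g\<close> on the cover by the first root
  need not itself be even or odd in that root, since it is not determined by \<open>f\<close> where one of the other \<open>Y\<^sub>j\<close>
  vanishes. But \<open>f\<close> is, so one of the two parts of \<open>g\<close> can be dropped after multiplication by these \<open>Y\<^sub>j\<close>.\<close>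

lemma semi_invariant_regular:
  assumes "wf_csys X" "set Rs \<subseteq> polys (nvars X)"
    and "regular (nvars X + length Rs) (cover X Rs) f"
    and "\<And>j x. j < length Rs \<Longrightarrow> x \<in> cover X Rs \<Longrightarrow>
      f (x(nvars X + j := - x (nvars X + j))) = (if j \<in> J then - f x else f x)"
  shows "\<exists>g. regular (nvars X) (cpoints X) g \<and>
    (\<forall>x\<in>cover X Rs. f x = (\<Prod>j<length Rs. if j \<in> J then x (nvars X + j) else 1) * g (truncate (nvars X) x))"
  using assms
proof (induction Rs arbitrary: X J)
  case Nil
  have "cover X [] = cpoints X"
    by (auto simp: mem_cpoints double_cover_def)
  moreover have "truncate (nvars X) x = x" if "x \<in> cpoints X" for x
    using that by (intro truncate_eqI) (simp add: mem_cpoints)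
  ultimately show ?case
    using Nil(3) by (intro exI[of _ f]) auto
next
  case (Cons R Rs X J)
  let ?n = "nvars X" and ?J = "{j. Suc j \<in> J}" and ?X = "with_root X R"
  let ?m = "\<lambda>x. \<Prod>j<length Rs. if j \<in> ?J then x (Suc ?n + j) else (1::complex)"
  have R: "R \<in> polys ?n" and Rs: "set Rs \<subseteq> polys (Suc ?n)"
    using Cons.prems(2) by (auto intro: polys_mono)
  note cover = cover_Cons[OF Cons.prems(1,2)]
  have "\<exists>g. regular (nvars ?X) (cpoints ?X) g \<and> (\<forall>x\<in>cover ?X Rs.
      f x = (\<Prod>j<length Rs. if j \<in> ?J then x (nvars ?X + j) else 1) * g (truncate (nvars ?X) x))"
  proof (rule Cons.IH)
    show "wf_csys ?X" using Cons.prems(1) R by (rule wf_with_root)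
    show "set Rs \<subseteq> polys (nvars ?X)" using Rs by simp
    show "regular (nvars ?X + length Rs) (cover ?X Rs) f" using Cons.prems(3) by (simp add: cover)
    show "f (x(nvars ?X + j := - x (nvars ?X + j))) = (if j \<in> ?J then - f x else f x)"
      if "j < length Rs" "x \<in> cover ?X Rs" for j x
      using Cons.prems(4)[of "Suc j" x] that by (simp add: cover fun_upd_def)
  qed
  then obtain g where reg: "regular (nvars ?X) (cpoints ?X) g"
    and eq: "\<forall>x\<in>cover ?X Rs.
      f x = (\<Prod>j<length Rs. if j \<in> ?J then x (nvars ?X + j) else 1) * g (truncate (nvars ?X) x)"
    by (elim exE conjE)
  have g: "f x = ?m x * g (truncate (Suc ?n) x)" if "x \<in> cover ?X Rs" for x
    using bspec[OF eq that] by (simp cong: if_cong)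
  obtain a b where ab: "regular ?n (cpoints X) a" "regular ?n (cpoints X) b"
    "\<forall>x\<in>cpoints ?X. g x = a (x(?n := 0)) + x ?n * b (x(?n := 0))"
    using regular_even_odd_parts[OF Cons.prems(1) R reg[unfolded nvars_with_root]]
    by (elim exE conjE)
  have f: "f x = ?m x * (a (truncate ?n x) + x ?n * b (truncate ?n x))" if "x \<in> cover ?X Rs" for x
  proof -
    have "truncate (Suc ?n) x \<in> cpoints ?X"
      using that Cons.prems(1) R Rs by (simp add: mem_cover wf_with_root)
    from bspec[OF ab(3) this] g[OF that] show ?thesis
      by (simp add: truncate_Suc) (simp add: truncate_def)
  qed
  have "f x = (\<Prod>j<length (R # Rs). if j \<in> J then x (?n + j) else 1) *
      (if 0 \<in> J then b (truncate ?n x) else a (truncate ?n x))" if x: "x \<in> cover X (R # Rs)" for x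
  proof -
    let ?x = "x(?n := - x ?n)"
    have x': "?x \<in> cover X (R # Rs)"
      using flip_mem_cover[OF Cons.prems(1,2) x, of 0] by simp
    have "truncate ?n ?x = truncate ?n x"
      by (auto simp: truncate_def)
    then have fl: "f ?x = ?m x * (a (truncate ?n x) - x ?n * b (truncate ?n x))"
      using f[of ?x] x' by (simp add: cover cong: if_cong)
    have sgn: "f ?x = (if 0 \<in> J then - f x else f x)"
      using Cons.prems(4)[of 0 x] x by (simp add: fun_upd_def)
    show ?thesis
    proof (cases "0 \<in> J")
      case True
      \<comment> \<open>Doubling cancels the even part of \<open>g\<close>; in the other case it cancels the odd part.\<close>
      then have "2 * f x = f x - f ?x" using sgn by simp
      also have "\<dots> = 2 * (?m x * (x ?n * b (truncate ?n x)))"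
        using f[of x] x fl by (simp add: cover algebra_simps)
      finally show ?thesis using True by (simp add: prod.lessThan_Suc_shift del: prod.lessThan_Suc cong: if_cong)
    next
      case False
      then have "2 * f x = f x + f ?x" using sgn by simp
      also have "\<dots> = 2 * (?m x * a (truncate ?n x))"
        using f[of x] x fl by (simp add: cover algebra_simps)
      finally show ?thesis using False by (simp add: prod.lessThan_Suc_shift del: prod.lessThan_Suc cong: if_cong)
    qed
  qed
  then show ?case
    using ab by (intro exI[of _ "\<lambda>s. if 0 \<in> J then b s else a s"]) (cases "0 \<in> J"; auto)
qed

section \<open>Isomorphisms over the reals\<close>

definition regular_map :: "real mpoly csys \<Rightarrow> real mpoly csys \<Rightarrow> ((nat \<Rightarrow> complex) \<Rightarrow> nat \<Rightarrow> complex) \<Rightarrow> bool" where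
  "regular_map X Y F \<longleftrightarrow>
     (\<forall>i<nvars Y. regular (nvars X) (cpoints X) (\<lambda>x. F x i)) \<and> (\<forall>x\<in>cpoints X. F x \<in> cpoints Y)"

definition regular_iso :: "real mpoly csys \<Rightarrow> real mpoly csys \<Rightarrow>
    ((nat \<Rightarrow> complex) \<Rightarrow> nat \<Rightarrow> complex) \<Rightarrow> ((nat \<Rightarrow> complex) \<Rightarrow> nat \<Rightarrow> complex) \<Rightarrow> bool" where
  "regular_iso X Y F G \<longleftrightarrow> regular_map X Y F \<and> regular_map Y X G \<and>
     (\<forall>x\<in>cpoints X. G (F x) = x) \<and> (\<forall>y\<in>cpoints Y. F (G y) = y)"

lemma nvars_complexify [simp]: "nvars (complexify X) = nvars X"
  by (simp add: complexify_def)

lemma fracs_of_regular_map: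
  assumes "regular_map X Y F"
  obtains P where "algebraic_map (complexify X) (complexify Y) (complexify_fracs P)"
    "\<forall>x\<in>cpoints X. fracs_apply (nvars Y) (complexify_fracs P) x = F x"
proof -
  have "\<forall>i. \<exists>pq. i < nvars Y \<longrightarrow> fst pq \<in> polys (nvars X) \<and> snd pq \<in> polys (nvars X) \<and>
      (\<forall>x\<in>cpoints X. ceval (snd pq) x \<noteq> 0 \<and> F x i = ceval (fst pq) x / ceval (snd pq) x)"
    using assms unfolding regular_map_def regular_def by fastforce
  then obtain P where P: "\<And>i. i < nvars Y \<Longrightarrow> fst (P i) \<in> polys (nvars X) \<and> snd (P i) \<in> polys (nvars X) \<and>
      (\<forall>x\<in>cpoints X. ceval (snd (P i)) x \<noteq> 0 \<and> F x i = ceval (fst (P i)) x / ceval (snd (P i)) x)"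
    by (elim choice[THEN exE]) blast
  have eq: "fracs_apply (nvars Y) (complexify_fracs P) x = F x" if "x \<in> cpoints X" for x
  proof
    have "F x \<in> cpoints Y" using assms that by (auto simp: regular_map_def)
    then show "fracs_apply (nvars Y) (complexify_fracs P) x i = F x i" for i
      using P[of i] that by (auto simp: fracs_apply_def complexify_fracs_def ceval_def mem_cpoints)
  qed
  show thesis
  proof (rule that)
    show "\<forall>x\<in>cpoints X. fracs_apply (nvars Y) (complexify_fracs P) x = F x"
      using eq by blast
    show "algebraic_map (complexify X) (complexify Y) (complexify_fracs P)"
      using P assms eq
      by (auto simp: algebraic_map_def regular_map_def complexify_fracs_def ceval_def)
  qed
qed

lemma isomorphic_over_R_if_regular_iso:
  assumes "regular_iso X Y F G"
  shows "isomorphic_over_R X Y"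
proof -
  have F: "regular_map X Y F" and G: "regular_map Y X G"
    using assms by (auto simp: regular_iso_def)
  obtain P where P: "algebraic_map (complexify X) (complexify Y) (complexify_fracs P)"
    "\<forall>x\<in>cpoints X. fracs_apply (nvars Y) (complexify_fracs P) x = F x"
    using fracs_of_regular_map[OF F] .
  obtain Q where Q: "algebraic_map (complexify Y) (complexify X) (complexify_fracs Q)"
    "\<forall>y\<in>cpoints Y. fracs_apply (nvars X) (complexify_fracs Q) y = G y"
    using fracs_of_regular_map[OF G] .
  have "inverse_algebraic_maps (complexify X) (complexify Y) (complexify_fracs P) (complexify_fracs Q)"
    using P Q assms by (auto simp: inverse_algebraic_maps_def regular_iso_def regular_map_def)
  then show ?thesis
    unfolding isomorphic_over_R_def by blast
qed

lemma class_of_eq_if_regular_iso: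
  assumes "wf_csys X" "wf_csys Y" "regular_iso X Y F G"
  shows "class_of X = class_of Y"
proof -
  have "frag_of X - frag_of Y \<in> K0_relations"
    using assms(1,2) isomorphic_over_R_if_regular_iso[OF assms(3)]
    unfolding K0_relations_def by blast
  then show ?thesis
    unfolding class_of_def by (simp add: K0.abs_eq_iff group_closure.base)
qed

section \<open>Comparing the summands of \<open>\<chi>\<close>\<close>

text \<open>The polynomials \<open>R\<close> and \<open>S \<circ> F\<close> agree up to the square of the function \<open>h\<close>. The function \<open>k\<close>
  is an inverse of \<open>h\<close> where \<open>R \<noteq> 0\<close>; it has to be regular on all of \<open>Y\<close> because it occurs in the
  inverse of the induced map between the covers, also over the zeros of \<open>S\<close>.\<close>

definition square_equiv :: "real mpoly csys \<Rightarrow> real mpoly csys \<Rightarrow>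
    ((nat \<Rightarrow> complex) \<Rightarrow> nat \<Rightarrow> complex) \<Rightarrow> real mpoly \<Rightarrow> real mpoly \<Rightarrow> bool" where
  "square_equiv X Y F R S \<longleftrightarrow>
     (\<exists>h k. regular (nvars X) (cpoints X) h \<and> regular (nvars Y) (cpoints Y) k \<and>
        (\<forall>x\<in>cpoints X. ceval S (F x) = ceval R x * (h x)\<^sup>2 \<and>
           (ceval R x \<noteq> 0 \<longrightarrow> h x * k (F x) = 1)))"

lemma square_equiv_uminus: "square_equiv X Y F R S \<Longrightarrow> square_equiv X Y F (- R) (- S)"
  by (simp add: square_equiv_def)

lemma mem_cpoints_with_neq: "x \<in> cpoints (with_neq X R) \<longleftrightarrow> x \<in> cpoints X \<and> ceval R x \<noteq> 0"
  by (auto simp: mem_cpoints with_neq_def)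

lemma nvars_with_neq [simp]: "nvars (with_neq X R) = nvars X"
  by (simp add: with_neq_def)

lemma wf_with_neq: "wf_csys X \<Longrightarrow> R \<in> polys (nvars X) \<Longrightarrow> wf_csys (with_neq X R)"
  by (auto simp: wf_csys_def with_neq_def)

lemma square_equiv_zero_iff:
  assumes "square_equiv X Y F R S" "x \<in> cpoints X"
  shows "ceval S (F x) = 0 \<longleftrightarrow> ceval R x = 0"
proof -
  obtain h k where "ceval S (F x) = ceval R x * (h x)\<^sup>2" "ceval R x \<noteq> 0 \<longrightarrow> h x * k (F x) = 1"
    using assms unfolding square_equiv_def by blast
  then show ?thesis by auto
qed

lemma regular_iso_with_neq:
  assumes "regular_iso X Y F G" "square_equiv X Y F R S"
  shows "regular_iso (with_neq X R) (with_neq Y S) F G"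
proof -
  have sub: "cpoints (with_neq X R) \<subseteq> cpoints X" "cpoints (with_neq Y S) \<subseteq> cpoints Y"
    by (auto simp: mem_cpoints_with_neq)
  have "ceval R (G y) \<noteq> 0" if "y \<in> cpoints (with_neq Y S)" for y
    using that assms square_equiv_zero_iff[OF assms(2), of "G y"]
    by (auto simp: regular_iso_def regular_map_def mem_cpoints_with_neq)
  then show ?thesis
    using assms(1) square_equiv_zero_iff[OF assms(2)] regular_subset[OF _ sub(1)] regular_subset[OF _ sub(2)]
    by (auto simp: regular_iso_def regular_map_def mem_cpoints_with_neq)
qed

lemma square_equiv_with_neq:
  assumes "square_equiv X Y F R' S'"
  shows "square_equiv (with_neq X R) (with_neq Y S) F R' S'"
proof -
  have sub: "cpoints (with_neq X R) \<subseteq> cpoints X" "cpoints (with_neq Y S) \<subseteq> cpoints Y"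
    by (auto simp: mem_cpoints_with_neq)
  then show ?thesis
    using assms regular_subset[OF _ sub(1)] regular_subset[OF _ sub(2)]
    unfolding square_equiv_def nvars_with_neq by blast
qed

text \<open>The isomorphism is \<open>(x, y) \<mapsto> (F x, y h(x))\<close> with inverse \<open>(x, y) \<mapsto> (G x, y k(x))\<close>. The two are
  inverse to each other because \<open>h k = 1\<close> where \<open>R \<noteq> 0\<close>, while \<open>y = 0\<close> where \<open>R = 0\<close>.\<close>

lemma regular_iso_with_root:
  assumes wf: "wf_csys X" "wf_csys Y" "R \<in> polys (nvars X)" "S \<in> polys (nvars Y)"
    and iso: "regular_iso X Y F G" and sq: "square_equiv X Y F R S"
  shows "\<exists>F' G'. regular_iso (with_root X R) (with_root Y S) F' G' \<and>
    (\<forall>x\<in>cpoints (with_root X R). (F' x)(nvars Y := 0) = F (x(nvars X := 0)))"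
proof -
  let ?n = "nvars X" and ?m = "nvars Y"
  let ?V = "cpoints (with_root X R)" and ?W = "cpoints (with_root Y S)"
  note V = mem_cpoints_with_root[OF wf(1,3)]
  note W = mem_cpoints_with_root[OF wf(2,4)]
  obtain h k where h: "regular ?n (cpoints X) h" and k: "regular ?m (cpoints Y) k"
    and hk: "\<forall>x\<in>cpoints X. ceval S (F x) = ceval R x * (h x)\<^sup>2 \<and> (ceval R x \<noteq> 0 \<longrightarrow> h x * k (F x) = 1)"
    using sq unfolding square_equiv_def by (elim exE conjE)
  have F: "F x \<in> cpoints Y" "G (F x) = x" if "x \<in> cpoints X" for x
    using iso that by (auto simp: regular_iso_def regular_map_def)
  have G: "G y \<in> cpoints X" "F (G y) = y" if "y \<in> cpoints Y" for y
    using iso that by (auto simp: regular_iso_def regular_map_def)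
  have X0: "x ?n = 0" if "x \<in> cpoints X" for x
    using that by (simp add: mem_cpoints)
  have Y0: "y ?m = 0" if "y \<in> cpoints Y" for y
    using that by (simp add: mem_cpoints)
  define F' where "F' x = (F (x(?n := 0)))(?m := x ?n * h (x(?n := 0)))" for x
  define G' where "G' y = (G (y(?m := 0)))(?n := y ?m * k (y(?m := 0)))" for y
  have F'0: "(F' x)(?m := 0) = F (x(?n := 0))" if "x \<in> ?V" for x
    using that Y0[OF F(1)] by (auto simp: F'_def V)
  have G'0: "(G' y)(?n := 0) = G (y(?m := 0))" if "y \<in> ?W" for y
    using that X0[OF G(1)] by (auto simp: G'_def W)
  have F'V: "F' x \<in> ?W" if "x \<in> ?V" for x
    unfolding W F'0[OF that] using that F(1) hk by (simp add: V F'_def power_mult_distrib)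
  have G'W: "G' y \<in> ?V" if "y \<in> ?W" for y
  proof -
    define s where "s = G (y(?m := 0))"
    have s: "s \<in> cpoints X" "F s = y(?m := 0)" and ym: "(y ?m)\<^sup>2 = ceval S (F s)"
      using that G by (auto simp: W s_def)
    have "(y ?m * k (F s))\<^sup>2 = ceval R s * (h s * k (F s))\<^sup>2"
      using bspec[OF hk s(1)] by (simp add: ym power_mult_distrib)
    also have "\<dots> = ceval R s"
      using bspec[OF hk s(1)] by (cases "ceval R s = 0") simp_all
    finally show ?thesis
      unfolding V G'0[OF that] using s by (simp add: G'_def flip: s_def)
  qed
  have G'F': "G' (F' x) = x" if "x \<in> ?V" for x
  proof -
    define s where "s = x(?n := 0)"
    have s: "s \<in> cpoints X" "(x ?n)\<^sup>2 = ceval R s"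
      using that by (auto simp: V s_def)
    have "x ?n * h s * k (F s) = x ?n"
      using bspec[OF hk s(1)] s(2) by (cases "ceval R s = 0") auto
    moreover have "G' (F' x) = s(?n := x ?n * h s * k (F s))"
      unfolding G'_def F'0[OF that] using F(2)[OF s(1)] by (simp add: F'_def flip: s_def)
    ultimately have "G' (F' x) = s(?n := x ?n)" by (simp only:)
    then show ?thesis by (simp add: s_def)
  qed
  have F'G': "F' (G' y) = y" if "y \<in> ?W" for y
  proof -
    define s where "s = G (y(?m := 0))"
    have s: "s \<in> cpoints X" "F s = y(?m := 0)" and ym: "(y ?m)\<^sup>2 = ceval S (F s)"
      using that G by (auto simp: W s_def)
    have "y ?m * k (F s) * h s = y ?m"
      using bspec[OF hk s(1)] ym by (cases "ceval R s = 0") (auto simp: mult.commute)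
    moreover have "F' (G' y) = (F s)(?m := y ?m * k (F s) * h s)"
      unfolding F'_def G'0[OF that] using s by (simp add: G'_def flip: s_def)
    ultimately have "F' (G' y) = (F s)(?m := y ?m)" by (simp only:)
    then show ?thesis by (simp add: s(2))
  qed
  have regF: "regular (Suc ?n) ?V (\<lambda>x. F' x i)" if "i < Suc ?m" for i
  proof (cases "i = ?m")
    case True
    have "regular (Suc ?n) ?V (\<lambda>x. h (x(?n := 0)))"
      by (rule regular_drop_coordinate[OF h]) (simp add: V)
    from regular_mult[OF regular_coordinate[of ?n] this] show ?thesis
      by (simp add: F'_def True)
  next
    case False
    then have "regular ?n (cpoints X) (\<lambda>x. F x i)"
      using iso that by (simp add: regular_iso_def regular_map_def)
    then have "regular (Suc ?n) ?V (\<lambda>x. F (x(?n := 0)) i)"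
      by (rule regular_drop_coordinate) (simp add: V)
    then show ?thesis using False by (simp add: F'_def)
  qed
  have regG: "regular (Suc ?m) ?W (\<lambda>y. G' y i)" if "i < Suc ?n" for i
  proof (cases "i = ?n")
    case True
    have "regular (Suc ?m) ?W (\<lambda>y. k (y(?m := 0)))"
      by (rule regular_drop_coordinate[OF k]) (simp add: W)
    from regular_mult[OF regular_coordinate[of ?m] this] show ?thesis
      by (simp add: G'_def True)
  next
    case False
    then have "regular ?m (cpoints Y) (\<lambda>y. G y i)"
      using iso that by (simp add: regular_iso_def regular_map_def)
    then have "regular (Suc ?m) ?W (\<lambda>y. G (y(?m := 0)) i)"
      by (rule regular_drop_coordinate) (simp add: W)
    then show ?thesis using False by (simp add: G'_def)
  qed
  have "regular_iso (with_root X R) (with_root Y S) F' G'"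
    using regF regG F'V G'W F'G' G'F' by (simp add: regular_iso_def regular_map_def)
  with F'0 show ?thesis by blast
qed

lemma square_equiv_with_root:
  assumes wf: "wf_csys X" "wf_csys Y" "R \<in> polys (nvars X)" "S \<in> polys (nvars Y)"
    and polys: "R' \<in> polys (nvars X)" "S' \<in> polys (nvars Y)"
    and sq: "square_equiv X Y F R' S'"
    and F': "\<And>x. x \<in> cpoints (with_root X R) \<Longrightarrow> (F' x)(nvars Y := 0) = F (x(nvars X := 0))"
  shows "square_equiv (with_root X R) (with_root Y S) F' R' S'"
proof -
  let ?n = "nvars X" and ?m = "nvars Y"
  obtain h k where h: "regular ?n (cpoints X) h" and k: "regular ?m (cpoints Y) k"
    and hk: "\<forall>x\<in>cpoints X. ceval S' (F x) = ceval R' x * (h x)\<^sup>2 \<and> (ceval R' x \<noteq> 0 \<longrightarrow> h x * k (F x) = 1)"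
    using sq unfolding square_equiv_def by (elim exE conjE)
  have R': "ceval R' (x(?n := 0)) = ceval R' x" and S': "ceval S' (x(?m := 0)) = ceval S' x" for x
    using polys by (auto intro: ceval_cong)
  show ?thesis
    unfolding square_equiv_def nvars_with_root
  proof (intro exI conjI ballI)
    show "regular (Suc ?n) (cpoints (with_root X R)) (\<lambda>x. h (x(?n := 0)))"
      by (rule regular_drop_coordinate[OF h]) (simp add: mem_cpoints_with_root wf)
    show "regular (Suc ?m) (cpoints (with_root Y S)) (\<lambda>y. k (y(?m := 0)))"
      by (rule regular_drop_coordinate[OF k]) (simp add: mem_cpoints_with_root wf)
  next
    fix x assume x: "x \<in> cpoints (with_root X R)"
    then have "x(?n := 0) \<in> cpoints X" by (simp add: mem_cpoints_with_root wf)
    note hk' = bspec[OF hk this]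
    show "ceval S' (F' x) = ceval R' x * (h (x(?n := 0)))\<^sup>2"
      using hk' S'[of "F' x"] R'[of x] by (simp add: F'[OF x])
    show "ceval R' x \<noteq> 0 \<longrightarrow> h (x(?n := 0)) * k ((F' x)(?m := 0)) = 1"
      using hk' R'[of x] by (simp add: F'[OF x])
  qed
qed

text \<open>The hypotheses pass to each of the three systems in the recursion for \<open>\<chi>\<close>, so the
  induction ends with isomorphic systems for every summand.\<close>

lemma chi_aux_eq_if_square_equiv:
  assumes "wf_csys X" "wf_csys Y" "set Rs \<subseteq> polys (nvars X)" "set Ss \<subseteq> polys (nvars Y)"
    and "regular_iso X Y F G" "list_all2 (square_equiv X Y F) Rs Ss"
  shows "chi_aux X Rs = chi_aux Y Ss"
  using assms
proof (induction Rs arbitrary: X Y Ss F G)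
  case Nil
  then show ?case using class_of_eq_if_regular_iso[OF Nil(1,2,5)] by simp
next
  case (Cons R Rs X Y Ss' F G)
  then obtain S Ss where Ss': "Ss' = S # Ss" and sq: "square_equiv X Y F R S"
    and sqs: "list_all2 (square_equiv X Y F) Rs Ss"
    by (auto simp: list_all2_Cons1)
  have R: "R \<in> polys (nvars X)" "set Rs \<subseteq> polys (nvars X)"
    and S: "S \<in> polys (nvars Y)" "set Ss \<subseteq> polys (nvars Y)"
    using Cons.prems(3,4) by (auto simp: Ss')
  \<comment> \<open>Used for \<open>R, S\<close> and for \<open>- R, - S\<close>.\<close>
  have root: "chi_aux (with_root X T) Rs = chi_aux (with_root Y U) Ss"
    if T: "T \<in> polys (nvars X)" and U: "U \<in> polys (nvars Y)" and TU: "square_equiv X Y F T U" for T U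
  proof -
    obtain F' G' where F': "regular_iso (with_root X T) (with_root Y U) F' G'"
      "\<forall>x\<in>cpoints (with_root X T). (F' x)(nvars Y := 0) = F (x(nvars X := 0))"
      using regular_iso_with_root[OF Cons.prems(1,2) T U Cons.prems(5) TU] by (elim exE conjE)
    have "square_equiv (with_root X T) (with_root Y U) F' R' S'"
      if "square_equiv X Y F R' S'" "R' \<in> set Rs" "S' \<in> set Ss" for R' S'
      using square_equiv_with_root[OF Cons.prems(1,2) T U _ _ that(1)] F'(2) that(2,3) R(2) S(2) by blast
    then have "list_all2 (square_equiv (with_root X T) (with_root Y U) F') Rs Ss"
      using sqs by (auto intro: list.rel_mono_strong)
    then show ?thesis
      using R S by (intro Cons.IH[OF wf_with_root[OF Cons.prems(1) T] wf_with_root[OF Cons.prems(2) U] _ _ F'(1)])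
        (auto intro: polys_mono)
  qed
  have "list_all2 (square_equiv (with_neq X R) (with_neq Y S) F) Rs Ss"
    using sqs by (rule list.rel_mono_strong) (rule square_equiv_with_neq)
  then have "chi_aux (with_neq X R) Rs = chi_aux (with_neq Y S) Ss"
    using R S by (intro Cons.IH[OF wf_with_neq[OF Cons.prems(1) R(1)] wf_with_neq[OF Cons.prems(2) S(1)] _ _
        regular_iso_with_neq[OF Cons.prems(5) sq]]) auto
  moreover have "chi_aux (with_root X R) Rs = chi_aux (with_root Y S) Ss"
    using R(1) S(1) sq by (rule root)
  moreover have "chi_aux (with_root X (- R)) Rs = chi_aux (with_root Y (- S)) Ss"
    using polys_uminus[OF R(1)] polys_uminus[OF S(1)] square_equiv_uminus[OF sq] by (rule root)
  ultimately show ?case by (simp add: Ss')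
qed

section \<open>The normal form of an equivariant isomorphism\<close>

lemma cover_lift:
  assumes "wf_csys X" "set Rs \<subseteq> polys (nvars X)" "s \<in> cpoints X"
  obtains x where "x \<in> cover X Rs" "truncate (nvars X) x = s"
proof
  let ?n = "nvars X"
  let ?x = "\<lambda>i. if i < ?n then s i else if i < ?n + length Rs then csqrt (ceval (Rs ! (i - ?n)) s) else 0"
  show t: "truncate ?n ?x = s"
    using assms(3) by (auto simp: truncate_def mem_cpoints fun_eq_iff)
  show "?x \<in> cover X Rs"
    using assms(3) unfolding mem_cover[OF assms(1,2)] t by simp
qed

text \<open>Flipping the sign of \<open>Y\<^sub>j\<close> fixes the first coordinates of \<open>\<Phi> x\<close> and those belonging to the other
  roots, and negates the one belonging to \<open>Y\<^sub>j\<close>. So each coordinate is semi-invariant, with at most one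
  odd root.\<close>

lemma equivariant_components:
  assumes wf: "wf_csys X" "set Rs \<subseteq> polys (nvars X)"
    and reg: "\<And>i. i < nvars X + length Rs \<Longrightarrow> regular (nvars X + length Rs) (cover X Rs) (\<lambda>x. \<Phi> x i)"
    and equiv: "\<And>j x. j < length Rs \<Longrightarrow> x \<in> cover X Rs \<Longrightarrow>
      \<Phi> (x(nvars X + j := - x (nvars X + j))) = (\<Phi> x)(nvars X + j := - \<Phi> x (nvars X + j))"
  shows "\<exists>F h. (\<forall>i<nvars X. regular (nvars X) (cpoints X) (\<lambda>s. F s i)) \<and>
    (\<forall>j<length Rs. regular (nvars X) (cpoints X) (h j)) \<and>
    (\<forall>x\<in>cover X Rs. truncate (nvars X) (\<Phi> x) = F (truncate (nvars X) x) \<and>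
      (\<forall>j<length Rs. \<Phi> x (nvars X + j) = x (nvars X + j) * h j (truncate (nvars X) x)))"
proof -
  let ?n = "nvars X" and ?r = "length Rs"
  have "\<exists>g. regular ?n (cpoints X) g \<and> (\<forall>x\<in>cover X Rs. \<Phi> x i = g (truncate ?n x))" if "i < ?n" for i
    using semi_invariant_regular[OF wf reg, of i "{}"] that by (simp add: equiv)
  then obtain f where f: "\<forall>i<?n. regular ?n (cpoints X) (f i)"
    "\<forall>i<?n. \<forall>x\<in>cover X Rs. \<Phi> x i = f i (truncate ?n x)"
    by metis
  have "\<exists>g. regular ?n (cpoints X) g \<and>
      (\<forall>x\<in>cover X Rs. \<Phi> x (?n + j) = x (?n + j) * g (truncate ?n x))" if "j < ?r" for j
  proof -
    have "(\<Prod>l<?r. if l \<in> {j} then x (?n + l) else 1) = x (?n + j)" for x :: "nat \<Rightarrow> complex"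
      using that by (simp add: prod.delta)
    then show ?thesis
      using semi_invariant_regular[OF wf reg, of "?n + j" "{j}"] that by (simp add: equiv)
  qed
  then obtain h where h: "\<forall>j<?r. regular ?n (cpoints X) (h j)"
    "\<forall>j<?r. \<forall>x\<in>cover X Rs. \<Phi> x (?n + j) = x (?n + j) * h j (truncate ?n x)"
    by metis
  let ?F = "\<lambda>s i. if i < ?n then f i s else 0"
  have "truncate ?n (\<Phi> x) = ?F (truncate ?n x)" if "x \<in> cover X Rs" for x
    using f(2) that by (auto simp: truncate_def[of _ "\<Phi> x"])
  moreover have "\<forall>i<?n. regular ?n (cpoints X) (\<lambda>s. ?F s i)"
    using f(1) by simp
  ultimately show ?thesis
    using h by (intro exI[of _ ?F] exI[of _ h]) blast
qed

text \<open>All identities on the base are checked at a lift to the cover, which exists over the complex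
  numbers. The relation between \<open>R\<^sub>j\<close> and \<open>S\<^sub>j\<close> is \<open>Y\<^sub>j\<^sup>2 = S\<^sub>j\<close> at the image of such a lift, and \<open>h\<^sub>j k\<^sub>j = 1\<close>
  comes from the coordinate \<open>Y\<^sub>j\<close> of \<open>\<Psi> (\<Phi> x) = x\<close>, after division by \<open>Y\<^sub>j \<noteq> 0\<close>.\<close>

lemma regular_iso_if_equivariant_iso:
  assumes wf: "wf_csys X" "set Rs \<subseteq> polys (nvars X)" "wf_csys Y" "set Ss \<subseteq> polys (nvars Y)"
    and len: "nvars Y = nvars X" "length Ss = length Rs"
    and \<Phi>: "\<And>x. x \<in> cover X Rs \<Longrightarrow> \<Phi> x \<in> cover Y Ss" "\<And>x. x \<in> cover X Rs \<Longrightarrow> \<Psi> (\<Phi> x) = x"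
    and \<Psi>: "\<And>y. y \<in> cover Y Ss \<Longrightarrow> \<Psi> y \<in> cover X Rs" "\<And>y. y \<in> cover Y Ss \<Longrightarrow> \<Phi> (\<Psi> y) = y"
    and reg: "\<And>i. i < nvars X + length Rs \<Longrightarrow> regular (nvars X + length Rs) (cover X Rs) (\<lambda>x. \<Phi> x i)"
      "\<And>i. i < nvars X + length Rs \<Longrightarrow> regular (nvars X + length Rs) (cover Y Ss) (\<lambda>y. \<Psi> y i)"
    and equiv: "\<And>j x. j < length Rs \<Longrightarrow> x \<in> cover X Rs \<Longrightarrow>
      \<Phi> (x(nvars X + j := - x (nvars X + j))) = (\<Phi> x)(nvars X + j := - \<Phi> x (nvars X + j))"
  shows "\<exists>F G. regular_iso X Y F G \<and> list_all2 (square_equiv X Y F) Rs Ss"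
proof -
  let ?n = "nvars X" and ?r = "length Rs"
  \<comment> \<open>The inverse of an equivariant map is equivariant.\<close>
  have equiv': "\<Psi> (y(?n + j := - y (?n + j))) = (\<Psi> y)(?n + j := - \<Psi> y (?n + j))"
    if "j < ?r" "y \<in> cover Y Ss" for j y
    using equiv[OF that(1) \<Psi>(1)[OF that(2)]] \<Phi>(2)[OF flip_mem_cover[OF wf(1,2) \<Psi>(1)[OF that(2)] that(1)]]
    by (simp add: \<Psi>(2)[OF that(2)])
  have "\<exists>F h. (\<forall>i<?n. regular ?n (cpoints X) (\<lambda>s. F s i)) \<and> (\<forall>j<?r. regular ?n (cpoints X) (h j)) \<and>
    (\<forall>x\<in>cover X Rs. truncate ?n (\<Phi> x) = F (truncate ?n x) \<and>
      (\<forall>j<?r. \<Phi> x (?n + j) = x (?n + j) * h j (truncate ?n x)))"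
    by (rule equivariant_components[OF wf(1,2)]) (fact reg(1) equiv)+
  then obtain F h where F: "\<forall>i<?n. regular ?n (cpoints X) (\<lambda>s. F s i)"
    and h: "\<forall>j<?r. regular ?n (cpoints X) (h j)"
    and Fh: "\<forall>x\<in>cover X Rs. truncate ?n (\<Phi> x) = F (truncate ?n x) \<and>
      (\<forall>j<?r. \<Phi> x (?n + j) = x (?n + j) * h j (truncate ?n x))"
    by (elim exE conjE)
  have "\<exists>G k. (\<forall>i<nvars Y. regular (nvars Y) (cpoints Y) (\<lambda>s. G s i)) \<and>
    (\<forall>j<length Ss. regular (nvars Y) (cpoints Y) (k j)) \<and>
    (\<forall>x\<in>cover Y Ss. truncate (nvars Y) (\<Psi> x) = G (truncate (nvars Y) x) \<and>
      (\<forall>j<length Ss. \<Psi> x (nvars Y + j) = x (nvars Y + j) * k j (truncate (nvars Y) x)))"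
    by (rule equivariant_components[OF wf(3,4)]) (use reg(2) equiv' len in simp_all)
  then obtain G k where G: "\<forall>i<?n. regular ?n (cpoints Y) (\<lambda>s. G s i)"
    and k: "\<forall>j<?r. regular ?n (cpoints Y) (k j)"
    and Gk: "\<forall>x\<in>cover Y Ss. truncate ?n (\<Psi> x) = G (truncate ?n x) \<and>
      (\<forall>j<?r. \<Psi> x (?n + j) = x (?n + j) * k j (truncate ?n x))"
    unfolding len by (elim exE conjE)
  note X = mem_cover[OF wf(1,2)] and Y = mem_cover[OF wf(3,4), unfolded len]
  have F_in: "F s \<in> cpoints Y" and GF: "G (F s) = s" if s: "s \<in> cpoints X" for s
  proof -
    obtain x where x: "x \<in> cover X Rs" "truncate ?n x = s"
      using cover_lift[OF wf(1,2) s] .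
    have Fs: "F s = truncate ?n (\<Phi> x)" using Fh x by simp
    then show "F s \<in> cpoints Y" using \<Phi>(1)[OF x(1)] by (simp add: Y)
    show "G (F s) = s" using bspec[OF Gk \<Phi>(1)[OF x(1)]] x \<Phi>(2)[OF x(1)] Fs by simp
  qed
  have G_in: "G s \<in> cpoints X" and FG: "F (G s) = s" if s: "s \<in> cpoints Y" for s
  proof -
    obtain y where y: "y \<in> cover Y Ss" "truncate ?n y = s"
      using cover_lift[OF wf(3,4) s] unfolding len .
    have Gs: "G s = truncate ?n (\<Psi> y)" using Gk y by simp
    then show "G s \<in> cpoints X" using \<Psi>(1)[OF y(1)] by (simp add: X)
    show "F (G s) = s" using bspec[OF Fh \<Psi>(1)[OF y(1)]] y \<Psi>(2)[OF y(1)] Gs by simp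
  qed
  have "regular_iso X Y F G"
    using F G F_in GF G_in FG by (simp add: regular_iso_def regular_map_def len)
  moreover have "square_equiv X Y F (Rs ! j) (Ss ! j)" if j: "j < ?r" for j
    unfolding square_equiv_def
  proof (intro exI conjI ballI impI)
    show "regular ?n (cpoints X) (h j)" "regular (nvars Y) (cpoints Y) (k j)"
      using h k j by (simp_all add: len)
  next
    fix s assume s: "s \<in> cpoints X"
    obtain x where x: "x \<in> cover X Rs" "truncate ?n x = s"
      using cover_lift[OF wf(1,2) s] .
    have Fs: "F s = truncate ?n (\<Phi> x)" and \<Phi>j: "\<Phi> x (?n + j) = x (?n + j) * h j s"
      using Fh x j by simp_all
    have xj: "(x (?n + j))\<^sup>2 = ceval (Rs ! j) s"
      using x j by (simp add: X)
    have "ceval (Ss ! j) (F s) = (\<Phi> x (?n + j))\<^sup>2"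
      using \<Phi>(1)[OF x(1)] j by (simp add: Y Fs)
    then show "ceval (Ss ! j) (F s) = ceval (Rs ! j) s * (h j s)\<^sup>2"
      by (simp add: \<Phi>j power_mult_distrib xj)
    have "x (?n + j) = \<Phi> x (?n + j) * k j (F s)"
      using bspec[OF Gk \<Phi>(1)[OF x(1)]] j \<Phi>(2)[OF x(1)] by (simp add: Fs)
    then have "x (?n + j) * 1 = x (?n + j) * (h j s * k j (F s))"
      by (simp add: \<Phi>j)
    moreover assume "ceval (Rs ! j) s \<noteq> 0"
    then have "x (?n + j) \<noteq> 0" using xj by auto
    ultimately show "h j s * k j (F s) = 1"
      unfolding mult_cancel_left by simp
  qed
  ultimately show ?thesis
    using len by (intro exI[of _ F] exI[of _ G]) (simp add: list_all2_conv_all_nth)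
qed

lemma sign_action_flip:
  "j < r \<Longrightarrow> sign_action n r (\<lambda>l. if l = j then - 1 else 1) x = x(n + j := - x (n + j))"
  by (auto simp: sign_action_def fun_eq_iff)

lemma fracs_apply_cnj:
  "fracs_apply m (complexify_fracs P) (cnj \<circ> x) = cnj \<circ> fracs_apply m (complexify_fracs P) x"
  by (auto simp: fracs_apply_def complexify_fracs_def fun_eq_iff simp flip: ceval_def simp: ceval_cnj)

theorem proposition2p2p3:
  fixes A B :: formula
  assumes "wf_formula A" and "wf_formula B"
    and "isomorphic_formulas A B"
  shows "chi A = chi B"
proof -
  obtain X Rs where A: "A = Formula X Rs" by (cases A)
  obtain Y Ss where B: "B = Formula Y Ss" by (cases B)
  let ?n = "nvars X" and ?r = "length Rs"
  let ?V = "double_cover (Formula X Rs)" and ?W = "double_cover (Formula Y Ss)"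
  have wf: "wf_csys X" "set Rs \<subseteq> polys (nvars X)" "wf_csys Y" "set Ss \<subseteq> polys (nvars Y)"
    using assms(1,2) by (simp_all add: wf_formula_def A B)
  have len: "nvars Y = nvars X" "length Ss = length Rs"
    using assms(3) by (simp_all add: isomorphic_formulas_def A B)
  have nv: "nvars ?V = ?n + ?r" "nvars ?W = ?n + ?r"
    by (simp_all add: double_cover_def Let_def len)
  obtain \<phi> where iso: "algebraic_iso (complexify ?V) (complexify ?W) (complexify_fracs \<phi>)"
    and equiv: "equivariant ?n ?r (complexify ?V) (complexify ?W) (complexify_fracs \<phi>)"
    using assms(3) by (auto simp: isomorphic_formulas_def A B Let_def)
  obtain \<psi> where inv: "inverse_algebraic_maps (complexify ?V) (complexify ?W) (complexify_fracs \<phi>) \<psi>"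
    using iso unfolding algebraic_iso_def by blast
  define \<Phi> where "\<Phi> = fracs_apply (?n + ?r) (complexify_fracs \<phi>)"
  define \<Psi> where "\<Psi> = fracs_apply (?n + ?r) \<psi>"
  have \<Phi>: "\<Phi> x \<in> cover Y Ss" "\<Psi> (\<Phi> x) = x" if "x \<in> cover X Rs" for x
    using inv that by (simp_all add: inverse_algebraic_maps_def algebraic_map_def \<Phi>_def \<Psi>_def nv)
  have \<Psi>: "\<Psi> y \<in> cover X Rs" "\<Phi> (\<Psi> y) = y" if "y \<in> cover Y Ss" for y
    using inv that by (simp_all add: inverse_algebraic_maps_def algebraic_map_def \<Phi>_def \<Psi>_def nv)
  have \<Phi>_cnj: "\<Phi> (cnj \<circ> x) = cnj \<circ> \<Phi> x" for x
    unfolding \<Phi>_def by (rule fracs_apply_cnj)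
  have \<Psi>_cnj: "\<Psi> (cnj \<circ> y) = cnj \<circ> \<Psi> y" if "y \<in> cover Y Ss" for y
    using \<Phi>(2)[OF cnj_cpoints[OF \<Psi>(1)[OF that]]] by (simp add: \<Phi>_cnj \<Psi>(2)[OF that])
  have "\<exists>F G. regular_iso X Y F G \<and> list_all2 (square_equiv X Y F) Rs Ss"
  proof (rule regular_iso_if_equivariant_iso[OF wf len \<Phi> \<Psi>])
    fix i assume i: "i < ?n + ?r"
    have "algebraic_map (complexify ?V) (complexify ?W) (complexify_fracs \<phi>)"
      using inv by (simp add: inverse_algebraic_maps_def)
    then show "regular (?n + ?r) (cover X Rs) (\<lambda>x. \<Phi> x i)"
      using i by (intro regularI[of "fst (\<phi> i)" _ "snd (\<phi> i)"])
        (auto simp: algebraic_map_def complexify_fracs_def nv ceval_def \<Phi>_def fracs_apply_def)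
    have "algebraic_map (complexify ?W) (complexify ?V) \<psi>"
      using inv by (simp add: inverse_algebraic_maps_def)
    then show "regular (?n + ?r) (cover Y Ss) (\<lambda>y. \<Psi> y i)"
      using i
      by (intro regular_if_commutes_with_cnj[of "fst (\<psi> i)" _ "snd (\<psi> i)"])
        (simp_all add: algebraic_map_def nv \<Psi>_cnj cnj_cpoints, simp add: \<Psi>_def fracs_apply_def)
  next
    fix j x assume j: "j < ?r" and x: "x \<in> cover X Rs"
    define e :: "nat \<Rightarrow> complex" where "e = (\<lambda>l. if l = j then - 1 else 1)"
    have "\<forall>l<?r. e l \<in> {1, - 1}" by (simp add: e_def)
    with spec[OF equiv[unfolded equivariant_def], of e] x
    have "\<Phi> (sign_action ?n ?r e x) = sign_action ?n ?r e (\<Phi> x)"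
      by (simp add: nv \<Phi>_def)
    then show "\<Phi> (x(?n + j := - x (?n + j))) = (\<Phi> x)(?n + j := - \<Phi> x (?n + j))"
      by (simp only: e_def sign_action_flip[OF j])
  qed
  then obtain F G where "regular_iso X Y F G" "list_all2 (square_equiv X Y F) Rs Ss"
    by (elim exE conjE)
  from chi_aux_eq_if_square_equiv[OF wf(1,3,2,4) this] show ?thesis
    by (simp add: chi_def A B)
qed

end
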